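(* Let $F$ be a unital 3-field. There exists a bijective correspondence between the unitization of $\mathcal{Q}$-algebras $A$ over $F$ and semi-direct products of 3-fields $J\rtimes F$: (1) For each $\mathcal{Q}$-algebra $A$ over $F$, the mapping $\pi_{A,F}:A_F^+\to F$, $(f,a)\mapsto f$, establishes the short exact sequence of unital 3-fields $0\to A\to A_F^+\to F\to 0$, which is split by $\sigma_{A,F}:f\mapsto(f,0)$, and so $A_F^+=A\rtimes F$. (2) Conversely, each split exact sequence $0\to J\to F_0\to F\to 0$ naturally defines the structure of a $\mathcal{Q}$-algebra over $F$ on $J$, and it follows that $F_0=J\rtimes F$ is isomorphic to $J_F^+$.
   Context: A unital 3-field is a set $F$ with an associative ternary addition $(a,b,c)\mapsto a+b+c$, in which each $a\in F$ has a querelement $\overline a\in F$ with $a+\overline a+b=b$ for all $b\in F$, and an associative binary multiplication with unit $1$ for which every element is invertible and which distributes over ternary sums. Morphisms preserve ternary addition and multiplication. Each unital 3-field $F$ is regarded as embedded, as the set of units, in a uniquely determined binary local ring $\mathcal{U}(F)$ with residue field $\mathbb{F}_2$, in such a way that the ternary sum of $F$ is the binary sum of $\mathcal{U}(F)$ applied twice. One has $\mathcal{U}(F)=\mathcal{Q}(F)\cup F$, where the binary non-unital ring $\mathcal{Q}(F)$ consists of the maps $q_{a,b}:F\to F$, $f\mapsto f+a+b$ ($a,b\in F$), and $q_{a,b}$ corresponds to the sum $a+b$ in $\mathcal{U}(F)$. A morphism $\varphi:F_1\to F_2$ induces a binary ring morphism $\mathcal{Q}(\varphi):\mathcal{Q}(F_1)\to\mathcal{Q}(F_2)$,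 $q_{a,b}\mapsto q_{\varphi(a),\varphi(b)}$; the kernel of $\varphi$ means the kernel of $\mathcal{Q}(\varphi)$, which is an ideal of $\mathcal{U}(F_1)$. A short exact sequence $0\to J\to F_0\to F\to 0$ of unital 3-fields is given by a surjective morphism $\pi:F_0\to F$ whose kernel is (identified with) $J$; it is split if $\pi$ has a right inverse morphism $\sigma:F\to F_0$, and then $F_0$ is called the semi-direct product $J\rtimes F$ of the ideal $J\subseteq\mathcal{Q}(F_0)$ and the subfield $F$. In this case $F$ acts on $J$ by $f.j=\sigma(f)j$. An algebra $A$ over $F$ is a binary ring (not assumed unital) on which $F$ acts such that, for all $f,f_1,f_2,f_3\in F$ and $a,a_1,a_2\in A$, $f(a_1+a_2)=fa_1+fa_2$, $(f_1+f_2+f_3)a=f_1a+f_2a+f_3a$, $(f_1f_2)a=f_1(f_2a)$ and $1a=a$. Its (ternary) unitization is $A_F^+=F\oplus A$ with componentwise ternary addition and the binary product $(f_1,a_1)(f_2,a_2)=(f_1f_2,\,f_1a_2+f_2a_1+a_1a_2)$. An algebra $A$ over $F$ is a $\mathcal{Q}$-algebra if for each $a\in A$ there is $a^{\#}\in A$ with $aa^{\#}=a+a^{\#}$.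
   Formalization: Algebras over F must also satisfy f(ab)=(fa)b=a(fb) and f1(f2a)=f2(f1a), else A_F^+ is not associative; split sequences must satisfy σ(f)j=jσ(f) (automatic if F_0 is commutative), else F_0 need not be isomorphic to J_F^+. *)

theory Defs
  imports "HOL-Algebra.Ring" "HOL-Algebra.Module" "HOL-Algebra.AbelCoset"
begin

section \<open>Unital 3-fields\<close>

record 'a three_field = "'a monoid" +
  tadd :: "'a \<Rightarrow> 'a \<Rightarrow> 'a \<Rightarrow> 'a"

text \<open>
  Ternary addition is commutative, as it must be for \<open>F\<close> to sit in a ring whose binary sum,
  applied twice, gives the ternary one; the other axioms do not imply this (consider
  \<open>a - b + c\<close> on the adjoint group of a radical ring). Multiplication is not assumed
  commutative. Symmetry in all three arguments follows from the two transpositions.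
\<close>

locale unital_three_field = group F for F (structure) +
  assumes tadd_closed:
      "\<lbrakk>a \<in> carrier F; b \<in> carrier F; c \<in> carrier F\<rbrakk> \<Longrightarrow> tadd F a b c \<in> carrier F"
    and tadd_assoc1:
      "\<lbrakk>a \<in> carrier F; b \<in> carrier F; c \<in> carrier F; d \<in> carrier F; e \<in> carrier F\<rbrakk>
        \<Longrightarrow> tadd F (tadd F a b c) d e = tadd F a (tadd F b c d) e"
    and tadd_assoc2:
      "\<lbrakk>a \<in> carrier F; b \<in> carrier F; c \<in> carrier F; d \<in> carrier F; e \<in> carrier F\<rbrakk>
        \<Longrightarrow> tadd F a (tadd F b c d) e = tadd F a b (tadd F c d e)"
    and tadd_comm12:
      "\<lbrakk>a \<in> carrier F; b \<in> carrier F; c \<in> carrier F\<rbrakk> \<Longrightarrow> tadd F a b c = tadd F b a c"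
    and tadd_comm23:
      "\<lbrakk>a \<in> carrier F; b \<in> carrier F; c \<in> carrier F\<rbrakk> \<Longrightarrow> tadd F a b c = tadd F a c b"
    and querelement:
      "a \<in> carrier F \<Longrightarrow> \<exists>a'\<in>carrier F. \<forall>b\<in>carrier F. tadd F a a' b = b"
    and distrib_left:
      "\<lbrakk>a \<in> carrier F; b \<in> carrier F; c \<in> carrier F; d \<in> carrier F\<rbrakk>
        \<Longrightarrow> d \<otimes> tadd F a b c = tadd F (d \<otimes> a) (d \<otimes> b) (d \<otimes> c)"
    and distrib_right:
      "\<lbrakk>a \<in> carrier F; b \<in> carrier F; c \<in> carrier F; d \<in> carrier F\<rbrakk>
        \<Longrightarrow> tadd F a b c \<otimes> d = tadd F (a \<otimes> d) (b \<otimes> d) (c \<otimes> d)"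

definition three_field_hom :: "'a three_field \<Rightarrow> 'b three_field \<Rightarrow> ('a \<Rightarrow> 'b) set" where
  "three_field_hom F G = {\<phi> \<in> hom F G.
     \<forall>a\<in>carrier F. \<forall>b\<in>carrier F. \<forall>c\<in>carrier F.
       \<phi> (tadd F a b c) = tadd G (\<phi> a) (\<phi> b) (\<phi> c)}"

definition three_field_iso :: "'a three_field \<Rightarrow> 'b three_field \<Rightarrow> ('a \<Rightarrow> 'b) set" where
  "three_field_iso F G = {\<phi> \<in> three_field_hom F G. bij_betw \<phi> (carrier F) (carrier G)}"


section \<open>Rings without unit\<close>

text \<open>
  Non-unital rings are carried by the library records \<^typ>\<open>'a ring\<close> and
  \<^typ>\<open>('f, 'a) module\<close>; the field \<^const>\<open>one\<close> of these records is never used.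
\<close>

locale nonunital_ring = abelian_group R for R (structure) +
  assumes m_closed: "\<lbrakk>a \<in> carrier R; b \<in> carrier R\<rbrakk> \<Longrightarrow> a \<otimes> b \<in> carrier R"
    and m_assoc: "\<lbrakk>a \<in> carrier R; b \<in> carrier R; c \<in> carrier R\<rbrakk>
        \<Longrightarrow> (a \<otimes> b) \<otimes> c = a \<otimes> (b \<otimes> c)"
    and l_distr: "\<lbrakk>a \<in> carrier R; b \<in> carrier R; c \<in> carrier R\<rbrakk>
        \<Longrightarrow> (a \<oplus> b) \<otimes> c = a \<otimes> c \<oplus> b \<otimes> c"
    and r_distr: "\<lbrakk>a \<in> carrier R; b \<in> carrier R; c \<in> carrier R\<rbrakk>
        \<Longrightarrow> c \<otimes> (a \<oplus> b) = c \<otimes> a \<oplus> c \<otimes> b"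

definition nonunital_ring_hom ::
    "('a, 'm) ring_scheme \<Rightarrow> ('b, 'n) ring_scheme \<Rightarrow> ('a \<Rightarrow> 'b) set" where
  "nonunital_ring_hom R S = hom R S \<inter> hom (add_monoid R) (add_monoid S)"


section \<open>The ring of a 3-field and kernels\<close>

text \<open>
  In the local ring of \<open>F\<close> the map \<open>q F a b\<close> is the sum \<open>a + b\<close>. Accordingly the sum of two
  such maps is their composite, and
  \<open>(a + b) (c + d) = (ac + ad + bc) + bd\<close>, \<open>f (a + b) = fa + fb\<close>, \<open>(a + b) f = af + bf\<close>
  give their product and their left and right products with units \<open>f\<close>. None of these
  depends on the representatives \<open>a\<close>, \<open>b\<close>, which is what the definite descriptions below
  rely on.
\<close>

definition q :: "'a three_field \<Rightarrow> 'a \<Rightarrow> 'a \<Rightarrow> ('a \<Rightarrow> 'a)" where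
  "q F a b = (\<lambda>f\<in>carrier F. tadd F f a b)"

definition Q_mult :: "'a three_field \<Rightarrow> ('a \<Rightarrow> 'a) \<Rightarrow> ('a \<Rightarrow> 'a) \<Rightarrow> ('a \<Rightarrow> 'a)" where
  "Q_mult F x y = (THE z. \<exists>a\<in>carrier F. \<exists>b\<in>carrier F. \<exists>c\<in>carrier F. \<exists>d\<in>carrier F.
     x = q F a b \<and> y = q F c d \<and>
     z = q F (tadd F (a \<otimes>\<^bsub>F\<^esub> c) (a \<otimes>\<^bsub>F\<^esub> d) (b \<otimes>\<^bsub>F\<^esub> c)) (b \<otimes>\<^bsub>F\<^esub> d))"

definition Q :: "'a three_field \<Rightarrow> ('a \<Rightarrow> 'a) ring" where
  "Q F = \<lparr>carrier = {q F a b | a b. a \<in> carrier F \<and> b \<in> carrier F},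
          mult = Q_mult F, one = undefined,
          zero = (\<lambda>f\<in>carrier F. f), add = (\<lambda>x y. compose (carrier F) x y)\<rparr>"

definition unit_lmult :: "'a three_field \<Rightarrow> 'a \<Rightarrow> ('a \<Rightarrow> 'a) \<Rightarrow> ('a \<Rightarrow> 'a)" where
  "unit_lmult F f x = (THE y. \<exists>a\<in>carrier F. \<exists>b\<in>carrier F.
     x = q F a b \<and> y = q F (f \<otimes>\<^bsub>F\<^esub> a) (f \<otimes>\<^bsub>F\<^esub> b))"

definition unit_rmult :: "'a three_field \<Rightarrow> ('a \<Rightarrow> 'a) \<Rightarrow> 'a \<Rightarrow> ('a \<Rightarrow> 'a)" where
  "unit_rmult F x f = (THE y. \<exists>a\<in>carrier F. \<exists>b\<in>carrier F.
     x = q F a b \<and> y = q F (a \<otimes>\<^bsub>F\<^esub> f) (b \<otimes>\<^bsub>F\<^esub> f))"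

definition Q_map ::
    "'a three_field \<Rightarrow> 'b three_field \<Rightarrow> ('a \<Rightarrow> 'b) \<Rightarrow> ('a \<Rightarrow> 'a) \<Rightarrow> ('b \<Rightarrow> 'b)" where
  "Q_map F G \<phi> x = (THE y. \<exists>a\<in>carrier F. \<exists>b\<in>carrier F. x = q F a b \<and> y = q G (\<phi> a) (\<phi> b))"

definition three_field_kernel ::
    "'a three_field \<Rightarrow> 'b three_field \<Rightarrow> ('a \<Rightarrow> 'b) \<Rightarrow> ('a \<Rightarrow> 'a) set" where
  "three_field_kernel F G \<phi> = a_kernel (Q F) (Q G) (Q_map F G \<phi>)"


section \<open>Split exact sequences\<close>

text \<open>
  The data of \<open>0 \<rightarrow> J \<rightarrow> F\<^sub>0 \<rightarrow> F \<rightarrow> 0\<close> over \<open>F\<close> with a section: the embedding \<open>incl\<close>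
  identifies \<open>J\<close> with the kernel of \<open>proj\<close>.
\<close>

record ('f, 'j, 'e) extension =
  ideal_part :: "'j ring"
  incl :: "'j \<Rightarrow> 'e \<Rightarrow> 'e"
  total :: "'e three_field"
  proj :: "'e \<Rightarrow> 'f"
  sect :: "'f \<Rightarrow> 'e"

definition short_exact :: "'f three_field \<Rightarrow> ('f, 'j, 'e) extension \<Rightarrow> bool" where
  "short_exact F E \<longleftrightarrow>
     nonunital_ring (ideal_part E) \<and> unital_three_field (total E) \<and> unital_three_field F \<and>
     proj E \<in> three_field_hom (total E) F \<and>
     proj E ` carrier (total E) = carrier F \<and>
     incl E \<in> nonunital_ring_hom (ideal_part E) (Q (total E)) \<and>
     inj_on (incl E) (carrier (ideal_part E)) \<and>
     incl E ` carrier (ideal_part E) = three_field_kernel (total E) F (proj E)"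

definition split_exact :: "'f three_field \<Rightarrow> ('f, 'j, 'e) extension \<Rightarrow> bool" where
  "split_exact F E \<longleftrightarrow> short_exact F E \<and>
     sect E \<in> three_field_hom F (total E) \<and> (\<forall>f\<in>carrier F. proj E (sect E f) = f)"

text \<open>
  \<open>\<sigma>(f) j = j \<sigma>(f)\<close> in the local ring of \<open>F\<^sub>0\<close>. This is automatic if multiplication is
  commutative (see below). Without commutativity it has to be required, since it holds in
  every unitization: there \<open>(f, 0) (0, a) = (0, fa) = (0, a) (f, 0)\<close>.
\<close>

definition section_commutes :: "'f three_field \<Rightarrow> ('f, 'j, 'e) extension \<Rightarrow> bool" where
  "section_commutes F E \<longleftrightarrow> (\<forall>f\<in>carrier F. \<forall>j\<in>carrier (ideal_part E).
     unit_lmult (total E) (sect E f) (incl E j) = unit_rmult (total E) (incl E j) (sect E f))"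

lemma section_commutes_if_comm:
  assumes "split_exact F E" and "comm_group (total E)"
  shows "section_commutes F E"
proof -
  interpret comm_group "total E" by fact
  have "sect E f \<in> carrier (total E)" if "f \<in> carrier F" for f
    using assms(1) that unfolding split_exact_def three_field_hom_def by (auto simp: hom_def)
  then show ?thesis
    unfolding section_commutes_def unit_lmult_def unit_rmult_def
    by (intro ballI arg_cong[where f = The]) (auto simp: fun_eq_iff m_comm)
qed

definition extension_iso ::
    "'f three_field \<Rightarrow> ('f, 'j, 'e) extension \<Rightarrow> ('f, 'k, 'd) extension
      \<Rightarrow> ('j \<Rightarrow> 'k) \<Rightarrow> ('e \<Rightarrow> 'd) \<Rightarrow> bool" where
  "extension_iso F E D g h \<longleftrightarrow>
     g \<in> nonunital_ring_hom (ideal_part E) (ideal_part D) \<and>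
     bij_betw g (carrier (ideal_part E)) (carrier (ideal_part D)) \<and>
     h \<in> three_field_iso (total E) (total D) \<and>
     (\<forall>j\<in>carrier (ideal_part E). Q_map (total E) (total D) h (incl E j) = incl D (g j)) \<and>
     (\<forall>x\<in>carrier (total E). proj D (h x) = proj E x) \<and>
     (\<forall>f\<in>carrier F. h (sect E f) = sect D f)"

definition extension_isomorphic ::
    "'f three_field \<Rightarrow> ('f, 'j, 'e) extension \<Rightarrow> ('f, 'k, 'd) extension \<Rightarrow> bool" where
  "extension_isomorphic F E D \<longleftrightarrow> (\<exists>g h. extension_iso F E D g h)"


section \<open>Algebras over a 3-field\<close>

text \<open>
  The axioms \<open>smult_mult_left\<close>, \<open>smult_mult_right\<close> and \<open>smult_smult_comm\<close> are the usual
  bilinearity of the product; together they say exactly that the product of the unitization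
  is associative. The last one is automatic for commutative \<open>F\<close>.
\<close>

locale three_field_algebra =
  fixes F :: "'f three_field" and A :: "('f, 'a) module" (structure)
  assumes base_field: "unital_three_field F"
    and algebra_ring: "nonunital_ring A"
    and smult_closed: "\<lbrakk>f \<in> carrier F; a \<in> carrier A\<rbrakk> \<Longrightarrow> f \<odot> a \<in> carrier A"
    and smult_add: "\<lbrakk>f \<in> carrier F; a \<in> carrier A; b \<in> carrier A\<rbrakk>
        \<Longrightarrow> f \<odot> (a \<oplus> b) = f \<odot> a \<oplus> f \<odot> b"
    and tadd_smult:
      "\<lbrakk>f1 \<in> carrier F; f2 \<in> carrier F; f3 \<in> carrier F; a \<in> carrier A\<rbrakk>
        \<Longrightarrow> tadd F f1 f2 f3 \<odot> a = f1 \<odot> a \<oplus> f2 \<odot> a \<oplus> f3 \<odot> a"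
    and mult_smult: "\<lbrakk>f1 \<in> carrier F; f2 \<in> carrier F; a \<in> carrier A\<rbrakk>
        \<Longrightarrow> (f1 \<otimes>\<^bsub>F\<^esub> f2) \<odot> a = f1 \<odot> (f2 \<odot> a)"
    and one_smult: "a \<in> carrier A \<Longrightarrow> \<one>\<^bsub>F\<^esub> \<odot> a = a"
    and smult_mult_left: "\<lbrakk>f \<in> carrier F; a \<in> carrier A; b \<in> carrier A\<rbrakk>
        \<Longrightarrow> f \<odot> (a \<otimes> b) = (f \<odot> a) \<otimes> b"
    and smult_mult_right: "\<lbrakk>f \<in> carrier F; a \<in> carrier A; b \<in> carrier A\<rbrakk>
        \<Longrightarrow> f \<odot> (a \<otimes> b) = a \<otimes> (f \<odot> b)"
    and smult_smult_comm: "\<lbrakk>f1 \<in> carrier F; f2 \<in> carrier F; a \<in> carrier A\<rbrakk>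
        \<Longrightarrow> f1 \<odot> (f2 \<odot> a) = f2 \<odot> (f1 \<odot> a)"

locale Q_algebra = three_field_algebra +
  assumes quasi_inverse: "a \<in> carrier A \<Longrightarrow> \<exists>a'\<in>carrier A. a \<otimes> a' = a \<oplus> a'"

definition algebra_isomorphic ::
    "'f three_field \<Rightarrow> ('f, 'a) module \<Rightarrow> ('f, 'b) module \<Rightarrow> bool" where
  "algebra_isomorphic F A B \<longleftrightarrow>
     (\<exists>g \<in> nonunital_ring_hom A B. bij_betw g (carrier A) (carrier B) \<and>
       (\<forall>f\<in>carrier F. \<forall>a\<in>carrier A. g (f \<odot>\<^bsub>A\<^esub> a) = f \<odot>\<^bsub>B\<^esub> g a))"

definition unitization :: "'f three_field \<Rightarrow> ('f, 'a) module \<Rightarrow> ('f \<times> 'a) three_field" where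
  "unitization F A =
     \<lparr>carrier = carrier F \<times> carrier A,
      mult = (\<lambda>(f1, a1) (f2, a2).
        (f1 \<otimes>\<^bsub>F\<^esub> f2, f1 \<odot>\<^bsub>A\<^esub> a2 \<oplus>\<^bsub>A\<^esub> f2 \<odot>\<^bsub>A\<^esub> a1 \<oplus>\<^bsub>A\<^esub> a1 \<otimes>\<^bsub>A\<^esub> a2)),
      one = (\<one>\<^bsub>F\<^esub>, \<zero>\<^bsub>A\<^esub>),
      tadd = (\<lambda>(f1, a1) (f2, a2) (f3, a3). (tadd F f1 f2 f3, a1 \<oplus>\<^bsub>A\<^esub> a2 \<oplus>\<^bsub>A\<^esub> a3))\<rparr>"

text \<open>
  The sequence \<open>0 \<rightarrow> A \<rightarrow> A\<^sub>F\<^sup>+ \<rightarrow> F \<rightarrow> 0\<close>. An element \<open>a\<close> of \<open>A\<close> is identified with the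
  element \<open>(0, a)\<close> of the local ring of the unitization, that is, with the translation
  by \<open>(0, a)\<close>.
\<close>

definition unitization_extension ::
    "'f three_field \<Rightarrow> ('f, 'a) module \<Rightarrow> ('f, 'a, 'f \<times> 'a) extension" where
  "unitization_extension F A =
     \<lparr>ideal_part = \<lparr>carrier = carrier A, mult = mult A, one = one A,
                     zero = zero A, add = add A\<rparr>,
      incl = (\<lambda>a. \<lambda>(f, b)\<in>carrier F \<times> carrier A. (f, b \<oplus>\<^bsub>A\<^esub> a)),
      total = unitization F A,
      proj = (\<lambda>(f, a). f),
      sect = (\<lambda>f. (f, \<zero>\<^bsub>A\<^esub>))\<rparr>"

text \<open>The action \<open>f.j = \<sigma>(f) j\<close> of \<open>F\<close> on the ideal of a split extension.\<close>

definition induced_algebra ::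
    "('f, 'j, 'e) extension \<Rightarrow> ('f, 'j) module" where
  "induced_algebra E =
     \<lparr>carrier = carrier (ideal_part E), mult = mult (ideal_part E), one = one (ideal_part E),
      zero = zero (ideal_part E), add = add (ideal_part E),
      smult = (\<lambda>f j. inv_into (carrier (ideal_part E)) (incl E)
                        (unit_lmult (total E) (sect E f) (incl E j)))\<rparr>"

end

theory Submission
  imports Defs
begin

text \<open>
  All computations take place in the local ring of a 3-field, in which ternary sums become iterated
  binary ones, \<open>Q F\<close> is the set of non-units and a translation \<open>x\<close> is determined by its value
  \<open>x \<one> = 1 + x\<close>. In a split extension every element of \<open>F\<^sub>0\<close> is uniquely \<open>\<sigma>(f) + j\<close> with \<open>j\<close> in
  the kernel, and \<open>(\<sigma>(f) + j) (\<sigma>(g) + k) = \<sigma>(fg) + (\<sigma>(f) k + \<sigma>(g) j + jk)\<close> is the product of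
  the unitization once \<open>\<sigma>(g)\<close> commutes with \<open>j\<close>. Quasi-inverses amount to invertibility of the
  elements \<open>1 + j\<close>: the equation \<open>a a' = a + a'\<close> says \<open>(1 - a) (1 - a') = 1\<close>.
\<close>

section \<open>The local ring of a 3-field\<close>

text \<open>The definitions know only ternary sums and translations, and the products in
  \<open>Q F\<close> are definite descriptions over representatives. Working with them directly
  would need an independence argument for each product and long rearrangements of nested ternary
  sums. The local ring is therefore built by hand from two copies of \<open>F\<close>, the units and
  their shifts by -1. Once it is a ring, ordinary ring calculation replaces ternary arithmetic, and
  \<open>x \<mapsto> (False, x \<one>)\<close> carries \<open>Q F\<close> injectively into it, so
  that both independence of representatives and identities between translations become equations
  there.

  A device used on both sides of the correspondence is to replace an element \<open>j\<close> of the
  ideal by the unit \<open>1 + j\<close>. Morphisms and the product of the unitization are given on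
  units only; what they do to \<open>j\<close> is read off from \<open>1 + j\<close> by cancelling
  in the local ring.\<close>

definition neg_one :: "'a three_field \<Rightarrow> 'a" where
  "neg_one F = (SOME n. n \<in> carrier F \<and> (\<forall>b\<in>carrier F. tadd F \<one>\<^bsub>F\<^esub> n b = b))"

text \<open>
  The pair \<open>(True, a)\<close> stands for the unit \<open>a\<close> and the pair \<open>(False, a)\<close> for \<open>a - 1\<close>.
\<close>

definition local_add :: "'a three_field \<Rightarrow> bool \<times> 'a \<Rightarrow> bool \<times> 'a \<Rightarrow> bool \<times> 'a" where
  "local_add F = (\<lambda>(i, a) (j, b).
     (i \<noteq> j, tadd F a b (if i \<and> j then \<one>\<^bsub>F\<^esub> else neg_one F)))"

text \<open>Multiplication is built in two stages. Units act from the left, with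
  \<open>a (b - 1) = ab - a\<close> written as a sum of two units; a left factor
  \<open>a - 1\<close> is then handled in \<open>local_ring\<close> by
  \<open>(a - 1) y = ay - y\<close>. The ring laws are first proved for the action.\<close>

definition local_act :: "'a three_field \<Rightarrow> 'a \<Rightarrow> bool \<times> 'a \<Rightarrow> bool \<times> 'a" where
  "local_act F a = (\<lambda>(j, b). if j then (True, a \<otimes>\<^bsub>F\<^esub> b)
     else local_add F (True, a \<otimes>\<^bsub>F\<^esub> b) (True, a \<otimes>\<^bsub>F\<^esub> neg_one F))"

definition local_ring :: "'a three_field \<Rightarrow> (bool \<times> 'a) ring" where
  "local_ring F =
     \<lparr>carrier = UNIV \<times> carrier F,
      mult = (\<lambda>(i, a) y. if i then local_act F a y
                else local_add F (local_act F a y) (local_act F (neg_one F) y)),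
      one = (True, \<one>\<^bsub>F\<^esub>), zero = (False, \<one>\<^bsub>F\<^esub>), add = local_add F\<rparr>"

locale three_field = unital_three_field F for F :: "'a three_field" (structure)
begin

abbreviation U where "U \<equiv> local_ring F"
abbreviation u where "u \<equiv> Pair True"
abbreviation neg1 where "neg1 \<equiv> neg_one F"

lemma neg_one_closed [simp, intro]: "neg1 \<in> carrier F"
  and tadd_neg_one: "b \<in> carrier F \<Longrightarrow> tadd F \<one> neg1 b = b"
proof -
  have "\<exists>n. n \<in> carrier F \<and> (\<forall>b\<in>carrier F. tadd F \<one> n b = b)"
    using querelement[OF one_closed] by blast
  from someI_ex[OF this] show "neg1 \<in> carrier F"
    and "b \<in> carrier F \<Longrightarrow> tadd F \<one> neg1 b = b"
    unfolding neg_one_def by auto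
qed

section \<open>The additive group of the local ring\<close>

lemma tadd_perm:
  assumes "a \<in> carrier F" "b \<in> carrier F" "c \<in> carrier F"
  shows "tadd F a b c = tadd F b a c" "tadd F a b c = tadd F a c b"
    "tadd F a b c = tadd F c b a"
  using assms tadd_comm12 tadd_comm23 by metis+

text \<open>A ternary form of left-commutativity: arguments cross the boundary of a nested sum, so
  that ordered rewriting with \<open>tadd_ac\<close> can sort nested sums.\<close>

lemma tadd_left_perm:
  assumes "a \<in> carrier F" "b \<in> carrier F" "c \<in> carrier F" "d \<in> carrier F" "e \<in> carrier F"
  shows "tadd F a b (tadd F c d e) = tadd F a c (tadd F b d e)"
    "tadd F a b (tadd F c d e) = tadd F c b (tadd F a d e)"
proof -
  show "tadd F a b (tadd F c d e) = tadd F a c (tadd F b d e)"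
    using assms tadd_assoc2[of a b c d e] tadd_assoc2[of a c b d e] tadd_comm12[of b c d] by simp
  show "tadd F a b (tadd F c d e) = tadd F c b (tadd F a d e)"
    using assms tadd_assoc1[of a b c d e] tadd_assoc1[of c b a d e]
      tadd_assoc2[of a b c d e] tadd_assoc2[of c b a d e] tadd_perm(3)[of a b c] by simp
qed

lemmas tadd_ac = tadd_assoc1 tadd_assoc2 tadd_perm tadd_left_perm

lemma local_carrier [simp]: "(i, a) \<in> carrier U \<longleftrightarrow> a \<in> carrier F"
  by (simp add: local_ring_def)

lemma local_zero: "\<zero>\<^bsub>U\<^esub> = (False, \<one>)"
  and local_one: "\<one>\<^bsub>U\<^esub> = u \<one>"
  by (simp_all add: local_ring_def)

lemma local_add_eq: "(i, a) \<oplus>\<^bsub>U\<^esub> (j, b) = (i \<noteq> j, tadd F a b (if i \<and> j then \<one> else neg1))"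
  by (simp add: local_ring_def local_add_def)

lemma local_abelian_group: "abelian_group U"
proof (rule abelian_groupI)
  show "\<exists>y\<in>carrier U. y \<oplus>\<^bsub>U\<^esub> x = \<zero>\<^bsub>U\<^esub>" if x: "x \<in> carrier U" for x
  proof -
    obtain i a where x: "x = (i, a)" "a \<in> carrier F" using x by (cases x) auto
    obtain a' where a': "a' \<in> carrier F" "\<forall>b\<in>carrier F. tadd F a a' b = b"
      using querelement x by blast
    \<comment> \<open>The negative of \<open>a - 1\<close> is
      \<open>1 - a = (-a + 1 + 1) - 1\<close>, and the pair tagged \<open>False\<close> stores the
      part in parentheses. The negative of a unit is simply its querelement.\<close>
    have "tadd F (tadd F a' \<one> \<one>) a neg1 = \<one>"
    proof -
      have "tadd F (tadd F a' \<one> \<one>) a neg1 = tadd F a a' (tadd F \<one> neg1 \<one>)"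
        using a'(1) x(2) by (simp add: tadd_ac tadd_closed)
      then show ?thesis using a' tadd_neg_one by simp
    qed
    moreover have "tadd F a' a \<one> = \<one>"
      using a' x tadd_comm12 by simp
    ultimately show ?thesis
      using a'(1) x
      by (intro bexI[where x="(i, if i then a' else tadd F a' \<one> \<one>)"])
        (simp_all add: local_add_eq local_zero tadd_closed)
  qed
next
  \<comment> \<open>In each parity case of associativity both sides are the same sum up to the
    places of the correction terms \<open>\<one>\<close> and \<open>neg1\<close>; the second
    identity lets these two trade places.\<close>
  have "tadd F (tadd F a b d) c e = tadd F a (tadd F b c d) e"
    "tadd F a (tadd F b c neg1) \<one> = tadd F a (tadd F b c \<one>) neg1"
    if "a \<in> carrier F" "b \<in> carrier F" "c \<in> carrier F" "d \<in> carrier F" "e \<in> carrier F"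
    for a b c d e
    using that by (simp_all add: tadd_ac tadd_closed)
  note * = this
  fix x y z assume "x \<in> carrier U" "y \<in> carrier U" "z \<in> carrier U"
  then obtain i a j b k c where "x = (i, a)" "y = (j, b)" "z = (k, c)"
    "a \<in> carrier F" "b \<in> carrier F" "c \<in> carrier F"
    by (cases x; cases y; cases z) auto
  then show "x \<oplus>\<^bsub>U\<^esub> y \<oplus>\<^bsub>U\<^esub> z = x \<oplus>\<^bsub>U\<^esub> (y \<oplus>\<^bsub>U\<^esub> z)"
    by (cases i; cases j; cases k) (simp_all add: local_add_eq tadd_closed *)
next
  fix x y assume "x \<in> carrier U" "y \<in> carrier U"
  then show "x \<oplus>\<^bsub>U\<^esub> y = y \<oplus>\<^bsub>U\<^esub> x" "x \<oplus>\<^bsub>U\<^esub> y \<in> carrier U"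
    by (cases x; cases y; auto simp: local_add_eq tadd_perm(1) tadd_closed)+
next
  show "\<zero>\<^bsub>U\<^esub> \<in> carrier U" by (simp add: local_zero)
next
  fix x assume "x \<in> carrier U"
  then show "\<zero>\<^bsub>U\<^esub> \<oplus>\<^bsub>U\<^esub> x = x"
    by (cases x) (simp add: local_zero local_add_eq tadd_perm(2)[of \<one> _ neg1] tadd_neg_one)
qed

interpretation U: abelian_group U by (rule local_abelian_group)

lemma u_tadd:
  assumes "a \<in> carrier F" "b \<in> carrier F" "c \<in> carrier F"
  shows "u (tadd F a b c) = u a \<oplus>\<^bsub>U\<^esub> u b \<oplus>\<^bsub>U\<^esub> u c"
proof -
  have "tadd F (tadd F a b \<one>) c neg1 = tadd F \<one> neg1 (tadd F a b c)"
    using assms by (simp add: tadd_ac tadd_closed)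
  then show ?thesis using assms tadd_neg_one tadd_closed by (simp add: local_add_eq)
qed

text \<open>Multiplying \<open>1 + n + 1 = 1\<close>, where n is \<open>neg1\<close>, by
  \<open>a\<close> gives \<open>a + an + a = a\<close>; cancelling one \<open>a\<close> leaves
  \<open>an + a = 0\<close>.\<close>

lemma u_neg_one: "a \<in> carrier F \<Longrightarrow> u (a \<otimes> neg1) = \<ominus>\<^bsub>U\<^esub> u a"
proof (rule U.minus_equality[symmetric])
  assume a: "a \<in> carrier F"
  have "u a \<oplus>\<^bsub>U\<^esub> (u (a \<otimes> neg1) \<oplus>\<^bsub>U\<^esub> u a) = u a"
    using u_tadd[of a "a \<otimes> neg1" a] distrib_left[of \<one> neg1 \<one> a] tadd_neg_one a
    by (simp add: U.a_assoc)
  then show "u (a \<otimes> neg1) \<oplus>\<^bsub>U\<^esub> u a = \<zero>\<^bsub>U\<^esub>"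
    using a by (metis U.add.l_cancel_one U.add.m_closed local_carrier m_closed neg_one_closed)
qed auto

lemma u_neg1: "u neg1 = \<ominus>\<^bsub>U\<^esub> \<one>\<^bsub>U\<^esub>"
  using u_neg_one[OF one_closed] by (simp add: local_one)

text \<open>Confirms inside the ring the intended reading of the tag \<open>False\<close>. Through
  \<open>local_cases\<close> most later arguments then speak of \<open>a\<close> and
  \<open>a - 1\<close> instead of pairs.\<close>

lemma False_eq: "a \<in> carrier F \<Longrightarrow> (False, a) = u a \<oplus>\<^bsub>U\<^esub> \<ominus>\<^bsub>U\<^esub> \<one>\<^bsub>U\<^esub>"
proof -
  assume a: "a \<in> carrier F"
  have "u a \<oplus>\<^bsub>U\<^esub> u neg1 = (False, a)"
    using a tadd_neg_one tadd_perm(3) tadd_perm(2) by (simp add: local_add_eq)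
  then show ?thesis by (simp add: u_neg1)
qed

lemma local_cases [consumes 1, case_names unit nonunit]:
  assumes "x \<in> carrier U"
  obtains a where "a \<in> carrier F" "x = u a" | a where "a \<in> carrier F" "x = u a \<oplus>\<^bsub>U\<^esub> \<ominus>\<^bsub>U\<^esub> \<one>\<^bsub>U\<^esub>"
  using assms False_eq by (cases x; cases "fst x") auto

section \<open>Units acting from the left\<close>

abbreviation act where "act \<equiv> local_act F"

lemma act_u: "act a (u b) = u (a \<otimes> b)"
  by (simp add: local_act_def)

lemma act_on_one: "a \<in> carrier F \<Longrightarrow> act a \<one>\<^bsub>U\<^esub> = u a"
  by (simp add: local_one act_u)

lemma act_minus:
  "a \<in> carrier F \<Longrightarrow> b \<in> carrier F \<Longrightarrow> act a (u b \<oplus>\<^bsub>U\<^esub> \<ominus>\<^bsub>U\<^esub> \<one>\<^bsub>U\<^esub>) = u (a \<otimes> b) \<oplus>\<^bsub>U\<^esub> \<ominus>\<^bsub>U\<^esub> u a"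
  by (simp add: False_eq[symmetric] local_act_def flip: u_neg_one) (simp add: local_ring_def)

lemma one_in [simp]: "\<one>\<^bsub>U\<^esub> \<in> carrier U" by (simp add: local_one)

lemma act_closed [simp]: "a \<in> carrier F \<Longrightarrow> x \<in> carrier U \<Longrightarrow> act a x \<in> carrier U"
  by (erule local_cases) (simp_all add: act_u act_minus)

lemma u_add_u:
  assumes "a \<in> carrier F" "b \<in> carrier F"
  shows "u a \<oplus>\<^bsub>U\<^esub> u b = u (tadd F a b \<one>) \<oplus>\<^bsub>U\<^esub> \<ominus>\<^bsub>U\<^esub> \<one>\<^bsub>U\<^esub>"
  using assms by (simp add: u_tadd local_one[symmetric] U.a_assoc U.r_neg)

lemma u_add_minus:
  assumes "a \<in> carrier F" "b \<in> carrier F"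
  shows "u a \<oplus>\<^bsub>U\<^esub> (u b \<oplus>\<^bsub>U\<^esub> \<ominus>\<^bsub>U\<^esub> \<one>\<^bsub>U\<^esub>) = u (tadd F a b neg1)"
  using assms by (simp add: u_tadd u_neg1 U.a_assoc)

lemma minus_add_minus:
  assumes "a \<in> carrier F" "b \<in> carrier F"
  shows "(u a \<oplus>\<^bsub>U\<^esub> \<ominus>\<^bsub>U\<^esub> \<one>\<^bsub>U\<^esub>) \<oplus>\<^bsub>U\<^esub> (u b \<oplus>\<^bsub>U\<^esub> \<ominus>\<^bsub>U\<^esub> \<one>\<^bsub>U\<^esub>) = u (tadd F a b neg1) \<oplus>\<^bsub>U\<^esub> \<ominus>\<^bsub>U\<^esub> \<one>\<^bsub>U\<^esub>"
  using assms by (simp add: u_tadd u_neg1 U.a_ac)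

text \<open>In each parity case the sum collapses to one unit, or one unit minus 1, with a ternary
  sum inside, and there ternary distributivity applies. The mixed case is proved for one order and
  transferred to the other by commutativity.\<close>

lemma act_add:
  assumes a: "a \<in> carrier F" and "x \<in> carrier U" "y \<in> carrier U"
  shows "act a (x \<oplus>\<^bsub>U\<^esub> y) = act a x \<oplus>\<^bsub>U\<^esub> act a y"
proof -
  have *: "act a (u b \<oplus>\<^bsub>U\<^esub> (u c \<oplus>\<^bsub>U\<^esub> \<ominus>\<^bsub>U\<^esub> \<one>\<^bsub>U\<^esub>)) = act a (u b) \<oplus>\<^bsub>U\<^esub> act a (u c \<oplus>\<^bsub>U\<^esub> \<ominus>\<^bsub>U\<^esub> \<one>\<^bsub>U\<^esub>)"
    if "b \<in> carrier F" "c \<in> carrier F" for b c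
    unfolding u_add_minus[OF that] using that a
    by (simp add: act_u act_minus distrib_left tadd_closed)
      (simp add: u_tadd u_neg_one U.a_assoc)
  from assms(2) show ?thesis
  proof (cases rule: local_cases)
    case x: (unit b)
    from assms(3) show ?thesis
    proof (cases rule: local_cases)
      case y: (unit c)
      show ?thesis
        unfolding x(2) y(2) u_add_u[OF x(1) y(1)] using x(1) y(1) a
        by (simp add: act_u act_minus distrib_left tadd_closed)
            (simp add: u_tadd U.a_assoc U.r_neg)
    next
      case (nonunit c)
      then show ?thesis using * x by simp
    qed
  next
    case x: (nonunit b)
    from assms(3) show ?thesis
    proof (cases rule: local_cases)
      case (unit c)
      then show ?thesis using *[of c b] x a U.a_comm[of x y] assms U.a_comm[of "act a x" "act a y"] by simp
    next
      case y: (nonunit c)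
      show ?thesis
        unfolding x(2) y(2) minus_add_minus[OF x(1) y(1)] using x(1) y(1) a
        by (simp add: act_minus distrib_left tadd_closed)
            (simp add: u_tadd u_neg_one U.a_ac)
    qed
  qed
qed

lemma act_neg:
  assumes "a \<in> carrier F" "x \<in> carrier U"
  shows "act a (\<ominus>\<^bsub>U\<^esub> x) = \<ominus>\<^bsub>U\<^esub> act a x"
proof -
  have 0: "act a \<zero>\<^bsub>U\<^esub> = \<zero>\<^bsub>U\<^esub>"
    using act_add[of a "\<zero>\<^bsub>U\<^esub>" "\<zero>\<^bsub>U\<^esub>"] assms by simp
  show ?thesis
    using act_add[of a "\<ominus>\<^bsub>U\<^esub> x" x] assms 0
    by (intro U.minus_equality[symmetric]) (simp_all add: U.l_neg)
qed

lemma act_act: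
  assumes "a \<in> carrier F" "b \<in> carrier F" "x \<in> carrier U"
  shows "act a (act b x) = act (a \<otimes> b) x"
  using assms(3)
  by (cases rule: local_cases)
    (use assms(1,2) in \<open>simp_all add: act_u act_minus m_assoc act_on_one act_add act_neg\<close>)

lemma act_tadd:
  assumes "a \<in> carrier F" "b \<in> carrier F" "c \<in> carrier F" "x \<in> carrier U"
  shows "act (tadd F a b c) x = act a x \<oplus>\<^bsub>U\<^esub> act b x \<oplus>\<^bsub>U\<^esub> act c x"
  using assms(4)
  by (cases rule: local_cases)
    (use assms(1-3) in \<open>simp_all add: act_u act_minus distrib_right u_tadd tadd_closed
       U.minus_add U.a_ac\<close>)

lemma act_one: "x \<in> carrier U \<Longrightarrow> act \<one> x = x"
  by (erule local_cases) (simp_all add: act_u act_minus flip: local_one)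

lemma act_neg1: "x \<in> carrier U \<Longrightarrow> act neg1 x = \<ominus>\<^bsub>U\<^esub> x"
proof (rule U.minus_equality[symmetric])
  assume x: "x \<in> carrier U"
  have "x \<oplus>\<^bsub>U\<^esub> (act neg1 x \<oplus>\<^bsub>U\<^esub> x) = x"
    using act_tadd[of \<one> neg1 \<one> x] act_one tadd_neg_one x
    by (simp add: U.a_assoc)
  then show "act neg1 x \<oplus>\<^bsub>U\<^esub> x = \<zero>\<^bsub>U\<^esub>"
    using x by (metis U.add.l_cancel_one U.add.m_closed act_closed neg_one_closed)
qed auto

section \<open>Multiplication and the ring axioms\<close>

lemma u_mult: "u a \<otimes>\<^bsub>U\<^esub> x = act a x"
  by (simp add: local_ring_def)

lemma minus_mult:
  "a \<in> carrier F \<Longrightarrow> x \<in> carrier U \<Longrightarrow> (u a \<oplus>\<^bsub>U\<^esub> \<ominus>\<^bsub>U\<^esub> \<one>\<^bsub>U\<^esub>) \<otimes>\<^bsub>U\<^esub> x = act a x \<oplus>\<^bsub>U\<^esub> \<ominus>\<^bsub>U\<^esub> x"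
  unfolding False_eq[symmetric] by (simp add: act_neg1[symmetric]) (simp add: local_ring_def)

lemma one_mult: "x \<in> carrier U \<Longrightarrow> \<one>\<^bsub>U\<^esub> \<otimes>\<^bsub>U\<^esub> x = x"
  by (simp add: local_one u_mult act_one)

lemma local_mult_closed: "x \<in> carrier U \<Longrightarrow> y \<in> carrier U \<Longrightarrow> x \<otimes>\<^bsub>U\<^esub> y \<in> carrier U"
  by (erule local_cases) (simp_all add: u_mult minus_mult)

lemma local_l_distr:
  assumes "x \<in> carrier U" "y \<in> carrier U" and z: "z \<in> carrier U"
  shows "(x \<oplus>\<^bsub>U\<^esub> y) \<otimes>\<^bsub>U\<^esub> z = x \<otimes>\<^bsub>U\<^esub> z \<oplus>\<^bsub>U\<^esub> y \<otimes>\<^bsub>U\<^esub> z"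
proof -
  have *: "(u b \<oplus>\<^bsub>U\<^esub> (u c \<oplus>\<^bsub>U\<^esub> \<ominus>\<^bsub>U\<^esub> \<one>\<^bsub>U\<^esub>)) \<otimes>\<^bsub>U\<^esub> z = u b \<otimes>\<^bsub>U\<^esub> z \<oplus>\<^bsub>U\<^esub> (u c \<oplus>\<^bsub>U\<^esub> \<ominus>\<^bsub>U\<^esub> \<one>\<^bsub>U\<^esub>) \<otimes>\<^bsub>U\<^esub> z"
    if "b \<in> carrier F" "c \<in> carrier F" for b c
    unfolding u_add_minus[OF that] using that z
    by (simp add: u_mult minus_mult act_tadd act_neg1 U.a_assoc
        tadd_closed)
  from assms(1) show ?thesis
  proof (cases rule: local_cases)
    case x: (unit b)
    from assms(2) show ?thesis
    proof (cases rule: local_cases)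
      case y: (unit c)
      show ?thesis
        unfolding x(2) y(2) u_add_u[OF x(1) y(1)] using x(1) y(1) z
        by (simp add: u_mult minus_mult act_tadd act_one U.a_assoc U.r_neg
        tadd_closed)
    next
      case (nonunit c)
      then show ?thesis using * x by simp
    qed
  next
    case x: (nonunit b)
    from assms(2) show ?thesis
    proof (cases rule: local_cases)
      case (unit c)
      then show ?thesis using *[of c b] x U.a_comm[of x y] assms
          U.a_comm[of "x \<otimes>\<^bsub>U\<^esub> z" "y \<otimes>\<^bsub>U\<^esub> z"] local_mult_closed by simp
    next
      case y: (nonunit c)
      show ?thesis
        unfolding x(2) y(2) minus_add_minus[OF x(1) y(1)] using x(1) y(1) z
        by (simp add: minus_mult act_tadd act_neg1 tadd_closed) (simp add: U.a_ac)
    qed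
  qed
qed

lemma local_l_minus:
  assumes "x \<in> carrier U" "z \<in> carrier U"
  shows "(\<ominus>\<^bsub>U\<^esub> x) \<otimes>\<^bsub>U\<^esub> z = \<ominus>\<^bsub>U\<^esub> (x \<otimes>\<^bsub>U\<^esub> z)"
proof -
  have 0: "\<zero>\<^bsub>U\<^esub> \<otimes>\<^bsub>U\<^esub> z = \<zero>\<^bsub>U\<^esub>"
    using local_l_distr[of "\<zero>\<^bsub>U\<^esub>" "\<zero>\<^bsub>U\<^esub>" z] assms local_mult_closed by simp
  show ?thesis
    using local_l_distr[of "\<ominus>\<^bsub>U\<^esub> x" x z] assms 0 local_mult_closed
    by (intro U.minus_equality[symmetric]) (simp_all add: U.l_neg)
qed

text \<open>Associativity with a unit as first factor. A first factor \<open>a - 1\<close> reduces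
  to it by distributivity, so this is the core of the associative law.\<close>

lemma local_act_mult:
  assumes a: "a \<in> carrier F" and y: "y \<in> carrier U" and z: "z \<in> carrier U"
  shows "act a y \<otimes>\<^bsub>U\<^esub> z = act a (y \<otimes>\<^bsub>U\<^esub> z)"
  using y
  by (cases rule: local_cases)
    (use a z in \<open>simp_all add: act_u act_minus u_mult minus_mult act_act local_l_distr
      local_l_minus act_add act_neg act_on_one one_mult\<close>)

lemma local_is_ring: "ring U"
proof (rule ringI[OF local_abelian_group])
  show "monoid U"
  proof (rule monoidI)
    fix x y z assume *: "x \<in> carrier U" "y \<in> carrier U" "z \<in> carrier U"
    show "x \<otimes>\<^bsub>U\<^esub> y \<otimes>\<^bsub>U\<^esub> z = x \<otimes>\<^bsub>U\<^esub> (y \<otimes>\<^bsub>U\<^esub> z)"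
      using *(1)
      by (cases rule: local_cases)
        (use *(2,3) in \<open>simp_all add: u_mult minus_mult local_act_mult local_mult_closed local_l_distr one_mult
           local_l_minus\<close>)
  next
    fix x assume x: "x \<in> carrier U"
    then show "\<one>\<^bsub>U\<^esub> \<otimes>\<^bsub>U\<^esub> x = x"
      by (simp add: local_one u_mult act_one)
    from x show "x \<otimes>\<^bsub>U\<^esub> \<one>\<^bsub>U\<^esub> = x"
      by (cases rule: local_cases) (simp_all add: u_mult minus_mult, simp_all add: local_one act_u)
  qed (simp_all add: local_mult_closed)
next
  fix x y z assume *: "x \<in> carrier U" "y \<in> carrier U" "z \<in> carrier U"
  then show "(x \<oplus>\<^bsub>U\<^esub> y) \<otimes>\<^bsub>U\<^esub> z = x \<otimes>\<^bsub>U\<^esub> z \<oplus>\<^bsub>U\<^esub> y \<otimes>\<^bsub>U\<^esub> z"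
    by (rule local_l_distr)
  show "z \<otimes>\<^bsub>U\<^esub> (x \<oplus>\<^bsub>U\<^esub> y) = z \<otimes>\<^bsub>U\<^esub> x \<oplus>\<^bsub>U\<^esub> z \<otimes>\<^bsub>U\<^esub> y"
    using *(3)
    by (cases rule: local_cases)
      (use *(1,2) in \<open>simp_all add: u_mult minus_mult act_add U.minus_add U.a_ac
       \<close>)
qed

sublocale U: ring U by (rule local_is_ring)

end

text \<open>The ideal of an extension and the algebra on it are different records with the same
  operations; this moves the ring axioms between them.\<close>

lemma nonunital_ring_cong:
  assumes "nonunital_ring R"
    and "carrier S = carrier R" "mult S = mult R" "add S = add R" "zero S = zero R"
  shows "nonunital_ring S"
proof -
  interpret R: nonunital_ring R by fact
  show ?thesis
  proof (intro nonunital_ring.intro nonunital_ring_axioms.intro abelian_groupI)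
    fix x assume "x \<in> carrier S"
    then show "\<exists>y\<in>carrier S. y \<oplus>\<^bsub>S\<^esub> x = \<zero>\<^bsub>S\<^esub>"
      using assms(2-5) by (intro bexI[where x = "\<ominus>\<^bsub>R\<^esub> x"]) (simp_all add: R.l_neg)
  qed (simp_all add: assms(2-5) R.m_closed R.m_assoc R.l_distr R.r_distr R.a_ac)
qed

lemma (in abelian_group) add_left_imp_eq:
  "x \<oplus> y = x \<oplus> z \<Longrightarrow> x \<in> carrier G \<Longrightarrow> y \<in> carrier G \<Longrightarrow> z \<in> carrier G \<Longrightarrow> y = z"
  by (metis r_neg1)

context nonunital_ring
begin

lemma l_null [simp]: "a \<in> carrier R \<Longrightarrow> \<zero> \<otimes> a = \<zero>"
  using l_distr[of \<zero> \<zero> a] m_closed[of \<zero> a] by simp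

lemma r_null [simp]: "a \<in> carrier R \<Longrightarrow> a \<otimes> \<zero> = \<zero>"
  using r_distr[of \<zero> \<zero> a] m_closed[of a \<zero>] by simp

lemma r_minus: "a \<in> carrier R \<Longrightarrow> b \<in> carrier R \<Longrightarrow> a \<otimes> \<ominus> b = \<ominus> (a \<otimes> b)"
  using r_distr[of "\<ominus> b" b a] m_closed
  by (intro minus_equality[symmetric]) (simp_all add: l_neg)

lemma l_minus: "a \<in> carrier R \<Longrightarrow> b \<in> carrier R \<Longrightarrow> \<ominus> a \<otimes> b = \<ominus> (a \<otimes> b)"
  using l_distr[of "\<ominus> a" a b] m_closed
  by (intro minus_equality[symmetric]) (simp_all add: l_neg)

end

section \<open>Translations as non-units of the local ring\<close>

context three_field
begin

text \<open>If \<open>x\<close> is the translation by \<open>t\<close>, then \<open>x \<one>\<close>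
  is \<open>1 + t\<close>, and the pair tagged \<open>False\<close> is
  \<open>(1 + t) - 1 = t\<close>, the element of the local ring that \<open>x\<close> stands
  for.\<close>

abbreviation v where "v x \<equiv> (False, x \<one>)"

lemma q_apply: "f \<in> carrier F \<Longrightarrow> q F a b f = tadd F f a b"
  by (simp add: q_def)

lemma q_closed [simp]: "a \<in> carrier F \<Longrightarrow> b \<in> carrier F \<Longrightarrow> q F a b \<in> carrier (Q F)"
  by (auto simp: Q_def)

lemma Q_cases [elim]:
  assumes "x \<in> carrier (Q F)"
  obtains a b where "a \<in> carrier F" "b \<in> carrier F" "x = q F a b"
  using assms by (auto simp: Q_def)

lemma v_q:
  assumes "a \<in> carrier F" "b \<in> carrier F"
  shows "v (q F a b) = u a \<oplus>\<^bsub>U\<^esub> u b"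
  using assms by (simp add: q_apply local_add_eq tadd_perm)

lemma u_apply:
  assumes "x \<in> carrier (Q F)" "f \<in> carrier F"
  shows "u (x f) = u f \<oplus>\<^bsub>U\<^esub> v x"
  using assms(1)
proof (rule Q_cases)
  fix a b assume *: "a \<in> carrier F" "b \<in> carrier F" "x = q F a b"
  show "u (x f) = u f \<oplus>\<^bsub>U\<^esub> v x"
    unfolding *(3) v_q[OF *(1,2)] using * assms(2) by (simp add: q_apply u_tadd U.a_assoc)
qed

lemma Q_apply_closed [simp]: "x \<in> carrier (Q F) \<Longrightarrow> f \<in> carrier F \<Longrightarrow> x f \<in> carrier F"
  by (erule Q_cases) (simp add: q_apply tadd_closed)

lemma Q_extensional: "x \<in> carrier (Q F) \<Longrightarrow> x \<in> extensional (carrier F)"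
  by (erule Q_cases) (simp add: q_def)

lemma Q_eqI:
  assumes "x \<in> carrier (Q F)" "y \<in> carrier (Q F)" "v x = v y"
  shows "x = y"
proof (rule extensionalityI[OF Q_extensional Q_extensional])
  fix f assume "f \<in> carrier F"
  then show "x f = y f" using u_apply[of x f] u_apply[of y f] assms by (metis Pair_inject)
qed (use assms in auto)

text \<open>The translation by \<open>a - 1\<close> sends 1 to \<open>a\<close>, so every element of
  \<open>F\<close> is the value at 1 of some translation.\<close>

lemma Q_ex:
  assumes "a \<in> carrier F"
  shows "q F a neg1 \<in> carrier (Q F)" "q F a neg1 \<one> = a"
  using assms tadd_neg_one[of a] tadd_perm(2)[of \<one> a neg1] by (simp_all add: q_apply)

text \<open>Independence of representatives, settled once for all the definite descriptions:
  candidates that name the same element \<open>w\<close> of the local ring coincide, because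
  \<open>v\<close> is injective on translations.\<close>

lemma Q_the:
  assumes "\<exists>z. P z" and "\<And>z. P z \<Longrightarrow> z \<in> carrier (Q F) \<and> v z = w"
  shows "(THE z. P z) \<in> carrier (Q F) \<and> v (THE z. P z) = w"
proof -
  have "\<exists>!z. P z"
    using assms(1)
  proof (rule ex_ex1I)
    fix y z assume "P y" "P z"
    from assms(2)[OF this(1)] assms(2)[OF this(2)] show "y = z"
      by (intro Q_eqI) simp_all
  qed
  from assms(2)[OF theI'[OF this]] show ?thesis .
qed

section \<open>Operations on translations as operations of the local ring\<close>

lemma u_mult_u: "u (a \<otimes> b) = u a \<otimes>\<^bsub>U\<^esub> u b"
  by (simp add: u_mult act_u)

lemma Q_zero: "\<zero>\<^bsub>Q F\<^esub> \<in> carrier (Q F)" "v \<zero>\<^bsub>Q F\<^esub> = \<zero>\<^bsub>U\<^esub>"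
proof -
  have "\<zero>\<^bsub>Q F\<^esub> = q F \<one> neg1"
    using tadd_neg_one tadd_perm(1,2)
    by (auto simp: Q_def q_def intro!: restrict_ext)
  then show "\<zero>\<^bsub>Q F\<^esub> \<in> carrier (Q F)" by simp
  show "v \<zero>\<^bsub>Q F\<^esub> = \<zero>\<^bsub>U\<^esub>" by (simp add: Q_def local_zero)
qed

lemma Q_add:
  assumes "x \<in> carrier (Q F)" "y \<in> carrier (Q F)"
  shows "x \<oplus>\<^bsub>Q F\<^esub> y \<in> carrier (Q F)" "v (x \<oplus>\<^bsub>Q F\<^esub> y) = v x \<oplus>\<^bsub>U\<^esub> v y"
proof -
  have eq: "u ((x \<oplus>\<^bsub>Q F\<^esub> y) f) = u f \<oplus>\<^bsub>U\<^esub> (v x \<oplus>\<^bsub>U\<^esub> v y)" if "f \<in> carrier F" for f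
    using that assms u_apply[of x "y f"] u_apply[of y f]
    by (simp add: Q_def compose_def U.a_ac)
  have "(x \<oplus>\<^bsub>Q F\<^esub> y) \<one> \<in> carrier F"
    using assms by (simp add: Q_def compose_def)
  then have "v (x \<oplus>\<^bsub>Q F\<^esub> y) = u ((x \<oplus>\<^bsub>Q F\<^esub> y) \<one>) \<oplus>\<^bsub>U\<^esub> \<ominus>\<^bsub>U\<^esub> \<one>\<^bsub>U\<^esub>"
    by (rule False_eq)
  also have "\<dots> = v x \<oplus>\<^bsub>U\<^esub> v y"
    unfolding eq[OF one_closed] local_one
    using assms U.a_comm[of "u \<one> \<oplus>\<^bsub>U\<^esub> (v x \<oplus>\<^bsub>U\<^esub> v y)" "\<ominus>\<^bsub>U\<^esub> u \<one>"] by (simp add: U.r_neg1)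
  finally show *: "v (x \<oplus>\<^bsub>Q F\<^esub> y) = v x \<oplus>\<^bsub>U\<^esub> v y" .
  \<comment> \<open>A composite is not given in the form \<open>q F a b\<close>. It is identified
    with the translation having the same value at 1, by comparing both at every argument.\<close>
  have "x \<oplus>\<^bsub>Q F\<^esub> y = q F ((x \<oplus>\<^bsub>Q F\<^esub> y) \<one>) neg1" (is "_ = ?z")
  proof (rule extensionalityI[of _ "carrier F"])
    have z: "?z \<in> carrier (Q F)" "v ?z = v (x \<oplus>\<^bsub>Q F\<^esub> y)"
      using Q_ex[OF \<open>(x \<oplus>\<^bsub>Q F\<^esub> y) \<one> \<in> carrier F\<close>] by auto
    show "?z \<in> extensional (carrier F)" using z Q_extensional by blast
    fix f assume f: "f \<in> carrier F"
    show "(x \<oplus>\<^bsub>Q F\<^esub> y) f = ?z f"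
      using eq[OF f] u_apply[OF z(1) f] unfolding z(2) * by (metis Pair_inject)
  qed (simp add: Q_def compose_def)
  then show "x \<oplus>\<^bsub>Q F\<^esub> y \<in> carrier (Q F)"
    using Q_ex[OF \<open>(x \<oplus>\<^bsub>Q F\<^esub> y) \<one> \<in> carrier F\<close>] by simp
qed

lemma Q_mult:
  assumes x: "x \<in> carrier (Q F)" and y: "y \<in> carrier (Q F)"
  shows "x \<otimes>\<^bsub>Q F\<^esub> y \<in> carrier (Q F)" "v (x \<otimes>\<^bsub>Q F\<^esub> y) = v x \<otimes>\<^bsub>U\<^esub> v y"
proof -
  let ?P = "\<lambda>z. \<exists>a\<in>carrier F. \<exists>b\<in>carrier F. \<exists>c\<in>carrier F. \<exists>d\<in>carrier F.
     x = q F a b \<and> y = q F c d \<and> z = q F (tadd F (a \<otimes> c) (a \<otimes> d) (b \<otimes> c)) (b \<otimes> d)"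
  have *: "z \<in> carrier (Q F) \<and> v z = v x \<otimes>\<^bsub>U\<^esub> v y" if "?P z" for z
  proof -
    from that obtain a b c d where abcd: "a \<in> carrier F" "b \<in> carrier F" "c \<in> carrier F" "d \<in> carrier F"
      and eq: "x = q F a b" "y = q F c d" "z = q F (tadd F (a \<otimes> c) (a \<otimes> d) (b \<otimes> c)) (b \<otimes> d)"
      by blast
    have "v z = u (tadd F (a \<otimes> c) (a \<otimes> d) (b \<otimes> c)) \<oplus>\<^bsub>U\<^esub> u (b \<otimes> d)"
      unfolding eq using abcd by (intro v_q) (auto simp: tadd_closed)
    also have "\<dots> = (u a \<oplus>\<^bsub>U\<^esub> u b) \<otimes>\<^bsub>U\<^esub> (u c \<oplus>\<^bsub>U\<^esub> u d)"
      using abcd by (simp add: u_tadd U.l_distr U.r_distr U.a_ac u_mult_u)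
    also have "\<dots> = v x \<otimes>\<^bsub>U\<^esub> v y"
      unfolding eq using abcd by (simp only: v_q)
    finally show ?thesis using eq abcd by (simp add: tadd_closed)
  qed
  have "\<exists>z. ?P z" using x y by (auto elim!: Q_cases) blast
  from Q_the[of ?P, OF this *] show "x \<otimes>\<^bsub>Q F\<^esub> y \<in> carrier (Q F)" "v (x \<otimes>\<^bsub>Q F\<^esub> y) = v x \<otimes>\<^bsub>U\<^esub> v y"
    by (simp_all add: Q_def Q_mult_def)
qed

lemma unit_lmult:
  assumes f: "f \<in> carrier F" and x: "x \<in> carrier (Q F)"
  shows "unit_lmult F f x \<in> carrier (Q F)" "v (unit_lmult F f x) = u f \<otimes>\<^bsub>U\<^esub> v x"
proof -
  let ?P = "\<lambda>y. \<exists>a\<in>carrier F. \<exists>b\<in>carrier F. x = q F a b \<and> y = q F (f \<otimes> a) (f \<otimes> b)"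
  have *: "y \<in> carrier (Q F) \<and> v y = u f \<otimes>\<^bsub>U\<^esub> v x" if "?P y" for y
  proof -
    from that obtain a b where ab: "a \<in> carrier F" "b \<in> carrier F"
      and eq: "x = q F a b" "y = q F (f \<otimes> a) (f \<otimes> b)"
      by blast
    have "v y = u (f \<otimes> a) \<oplus>\<^bsub>U\<^esub> u (f \<otimes> b)"
      unfolding eq using ab f by (intro v_q) auto
    also have "\<dots> = u f \<otimes>\<^bsub>U\<^esub> (u a \<oplus>\<^bsub>U\<^esub> u b)"
      using ab f by (simp add: U.r_distr u_mult_u)
    also have "\<dots> = u f \<otimes>\<^bsub>U\<^esub> v x"
      unfolding eq using ab by (simp only: v_q)
    finally show ?thesis using eq ab f by simp
  qed
  have "\<exists>y. ?P y" using x by (auto elim!: Q_cases)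
  from Q_the[of ?P, OF this *] show "unit_lmult F f x \<in> carrier (Q F)" "v (unit_lmult F f x) = u f \<otimes>\<^bsub>U\<^esub> v x"
    by (simp_all add: unit_lmult_def)
qed

lemma unit_rmult:
  assumes f: "f \<in> carrier F" and x: "x \<in> carrier (Q F)"
  shows "unit_rmult F x f \<in> carrier (Q F)" "v (unit_rmult F x f) = v x \<otimes>\<^bsub>U\<^esub> u f"
proof -
  let ?P = "\<lambda>y. \<exists>a\<in>carrier F. \<exists>b\<in>carrier F. x = q F a b \<and> y = q F (a \<otimes> f) (b \<otimes> f)"
  have *: "y \<in> carrier (Q F) \<and> v y = v x \<otimes>\<^bsub>U\<^esub> u f" if "?P y" for y
  proof -
    from that obtain a b where ab: "a \<in> carrier F" "b \<in> carrier F"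
      and eq: "x = q F a b" "y = q F (a \<otimes> f) (b \<otimes> f)"
      by blast
    have "v y = u (a \<otimes> f) \<oplus>\<^bsub>U\<^esub> u (b \<otimes> f)"
      unfolding eq using ab f by (intro v_q) auto
    also have "\<dots> = (u a \<oplus>\<^bsub>U\<^esub> u b) \<otimes>\<^bsub>U\<^esub> u f"
      using ab f by (simp add: U.l_distr u_mult_u)
    also have "\<dots> = v x \<otimes>\<^bsub>U\<^esub> u f"
      unfolding eq using ab by (simp only: v_q)
    finally show ?thesis using eq ab f by simp
  qed
  have "\<exists>y. ?P y" using x by (auto elim!: Q_cases)
  from Q_the[of ?P, OF this *] show "unit_rmult F x f \<in> carrier (Q F)" "v (unit_rmult F x f) = v x \<otimes>\<^bsub>U\<^esub> u f"
    by (simp_all add: unit_rmult_def)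
qed

end

section \<open>Morphisms, induced maps and kernels\<close>

lemma three_field_homD:
  assumes "\<phi> \<in> three_field_hom F G"
  shows "a \<in> carrier F \<Longrightarrow> \<phi> a \<in> carrier G"
    and "a \<in> carrier F \<Longrightarrow> b \<in> carrier F \<Longrightarrow> \<phi> (a \<otimes>\<^bsub>F\<^esub> b) = \<phi> a \<otimes>\<^bsub>G\<^esub> \<phi> b"
    and "a \<in> carrier F \<Longrightarrow> b \<in> carrier F \<Longrightarrow> c \<in> carrier F
      \<Longrightarrow> \<phi> (tadd F a b c) = tadd G (\<phi> a) (\<phi> b) (\<phi> c)"
  using assms by (auto simp: three_field_hom_def hom_def)

lemma three_field_hom_one:
  assumes "three_field F" "three_field G" "\<phi> \<in> three_field_hom F G"
  shows "\<phi> \<one>\<^bsub>F\<^esub> = \<one>\<^bsub>G\<^esub>"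
proof -
  interpret F: three_field F by fact
  interpret G: three_field G by fact
  show ?thesis
    using assms(3) by (intro hom_one) (auto simp: three_field_hom_def F.is_group G.is_group)
qed

text \<open>Since \<open>neg_one\<close> is obtained by choice, its preservation rests on
  uniqueness: the single equation \<open>1 + n + 1 = 1\<close> already forces \<open>n = -1\<close>
  by cancellation in the local ring.\<close>

lemma three_field_hom_neg_one:
  assumes "three_field F" "three_field G" "\<phi> \<in> three_field_hom F G"
  shows "\<phi> (neg_one F) = neg_one G"
proof -
  interpret F: three_field F by fact
  interpret G: three_field G by fact
  have \<phi>: "\<phi> F.neg1 \<in> carrier G" by (simp add: three_field_homD(1)[OF assms(3)])
  have "tadd G \<one>\<^bsub>G\<^esub> (\<phi> F.neg1) \<one>\<^bsub>G\<^esub> = \<phi> (tadd F \<one>\<^bsub>F\<^esub> F.neg1 \<one>\<^bsub>F\<^esub>)"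
    by (simp add: three_field_homD(3)[OF assms(3)] three_field_hom_one[OF assms])
  also have "\<dots> = \<one>\<^bsub>G\<^esub>" by (simp add: F.tadd_neg_one three_field_hom_one[OF assms])
  finally have "G.u \<one>\<^bsub>G\<^esub> \<oplus>\<^bsub>G.U\<^esub> (G.u (\<phi> F.neg1) \<oplus>\<^bsub>G.U\<^esub> G.u \<one>\<^bsub>G\<^esub>) = G.u \<one>\<^bsub>G\<^esub>"
    using G.u_tadd[OF _ \<phi>, of "\<one>\<^bsub>G\<^esub>" "\<one>\<^bsub>G\<^esub>"] \<phi> by (simp add: G.U.a_assoc)
  then have "G.u (\<phi> F.neg1) \<oplus>\<^bsub>G.U\<^esub> G.u \<one>\<^bsub>G\<^esub> = \<zero>\<^bsub>G.U\<^esub>"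
    using \<phi> by (metis G.U.add.l_cancel_one G.U.add.m_closed G.local_carrier G.one_closed)
  then have "G.u (\<phi> F.neg1) = G.u G.neg1"
    using \<phi> G.U.minus_equality[of "G.u (\<phi> F.neg1)" "G.u \<one>\<^bsub>G\<^esub>"] by (simp add: G.u_neg1 G.local_one)
  then show ?thesis by simp
qed

lemma Q_map:
  assumes "three_field F" "three_field G" "\<phi> \<in> three_field_hom F G" "x \<in> carrier (Q F)"
  shows "Q_map F G \<phi> x \<in> carrier (Q G)" "Q_map F G \<phi> x \<one>\<^bsub>G\<^esub> = \<phi> (x \<one>\<^bsub>F\<^esub>)"
proof -
  interpret F: three_field F by fact
  interpret G: three_field G by fact
  let ?P = "\<lambda>y. \<exists>a\<in>carrier F. \<exists>b\<in>carrier F. x = q F a b \<and> y = q G (\<phi> a) (\<phi> b)"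
  \<comment> \<open>As \<open>v\<close> looks only at the value at 1, a constant function is enough
    to name the target element.\<close>
  have *: "y \<in> carrier (Q G) \<and> G.v y = G.v (\<lambda>_. \<phi> (x \<one>\<^bsub>F\<^esub>))" if "?P y" for y
    using that by (auto simp: F.q_apply G.q_apply three_field_homD[OF assms(3)]
        three_field_hom_one[OF assms(1-3)])
  have "\<exists>y. ?P y" using assms(4) by (auto elim!: F.Q_cases)
  from G.Q_the[of ?P, OF this *] show "Q_map F G \<phi> x \<in> carrier (Q G)" "Q_map F G \<phi> x \<one>\<^bsub>G\<^esub> = \<phi> (x \<one>\<^bsub>F\<^esub>)"
    by (simp_all add: Q_map_def)
qed

text \<open>A translation is zero when it fixes 1, and the induced map acts on values at 1 as the
  morphism does. So \<open>x\<close> lies in the kernel exactly when \<open>1 + x\<close> is mapped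
  to 1, a condition on units alone.\<close>

lemma three_field_kernel_iff:
  assumes "three_field F" "three_field G" "\<phi> \<in> three_field_hom F G"
  shows "x \<in> three_field_kernel F G \<phi> \<longleftrightarrow> x \<in> carrier (Q F) \<and> \<phi> (x \<one>\<^bsub>F\<^esub>) = \<one>\<^bsub>G\<^esub>"
proof -
  interpret F: three_field F by fact
  interpret G: three_field G by fact
  have "Q_map F G \<phi> x = \<zero>\<^bsub>Q G\<^esub> \<longleftrightarrow> \<phi> (x \<one>\<^bsub>F\<^esub>) = \<one>\<^bsub>G\<^esub>" if x: "x \<in> carrier (Q F)"
    using Q_map[OF assms x] G.Q_zero G.Q_eqI by (auto simp: G.local_zero)
  then show ?thesis
    by (auto simp: three_field_kernel_def a_kernel_def kernel_def)
qed

section \<open>Split extensions\<close>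

lemma nonunital_ring_homD:
  assumes "h \<in> nonunital_ring_hom R S"
  shows "a \<in> carrier R \<Longrightarrow> h a \<in> carrier S"
    and "a \<in> carrier R \<Longrightarrow> b \<in> carrier R \<Longrightarrow> h (a \<otimes>\<^bsub>R\<^esub> b) = h a \<otimes>\<^bsub>S\<^esub> h b"
    and "a \<in> carrier R \<Longrightarrow> b \<in> carrier R \<Longrightarrow> h (a \<oplus>\<^bsub>R\<^esub> b) = h a \<oplus>\<^bsub>S\<^esub> h b"
  using assms by (auto simp: nonunital_ring_hom_def hom_def)

lemma nonunital_ring_homI:
  assumes "\<And>a. a \<in> carrier R \<Longrightarrow> h a \<in> carrier S"
    and "\<And>a b. a \<in> carrier R \<Longrightarrow> b \<in> carrier R \<Longrightarrow> h (a \<otimes>\<^bsub>R\<^esub> b) = h a \<otimes>\<^bsub>S\<^esub> h b"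
    and "\<And>a b. a \<in> carrier R \<Longrightarrow> b \<in> carrier R \<Longrightarrow> h (a \<oplus>\<^bsub>R\<^esub> b) = h a \<oplus>\<^bsub>S\<^esub> h b"
  shows "h \<in> nonunital_ring_hom R S"
  using assms by (auto simp: nonunital_ring_hom_def hom_def)

locale split_extension =
  fixes F :: "'f three_field" and E :: "('f, 'j, 'e) extension"
  assumes split_exact: "split_exact F E"
begin

sublocale F: three_field F
  using split_exact by (auto simp: split_exact_def short_exact_def intro: three_field.intro)

sublocale T: three_field "total E"
  using split_exact by (auto simp: split_exact_def short_exact_def intro: three_field.intro)

sublocale J: nonunital_ring "ideal_part E"
  using split_exact by (auto simp: split_exact_def short_exact_def)

abbreviation J where "J \<equiv> ideal_part E"
abbreviation T where "T \<equiv> total E"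
abbreviation \<pi> where "\<pi> \<equiv> proj E"
abbreviation \<sigma> where "\<sigma> \<equiv> sect E"
abbreviation \<iota> where "\<iota> j \<equiv> T.v (incl E j)"

lemma proj_hom: "\<pi> \<in> three_field_hom T F"
  and sect_hom: "\<sigma> \<in> three_field_hom F T"
  and incl_hom: "incl E \<in> nonunital_ring_hom J (Q T)"
  and incl_inj: "inj_on (incl E) (carrier J)"
  and proj_sect [simp]: "f \<in> carrier F \<Longrightarrow> \<pi> (\<sigma> f) = f"
  using split_exact by (auto simp: split_exact_def short_exact_def)

lemmas proj_simps [simp] = three_field_homD[OF proj_hom]
  three_field_hom_one[OF T.three_field_axioms F.three_field_axioms proj_hom]
lemmas sect_simps [simp] = three_field_homD[OF sect_hom]
  three_field_hom_one[OF F.three_field_axioms T.three_field_axioms sect_hom]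
lemmas incl_closed [simp] = nonunital_ring_homD(1)[OF incl_hom]

lemma incl_image: "x \<in> incl E ` carrier J \<longleftrightarrow> x \<in> carrier (Q T) \<and> \<pi> (x \<one>\<^bsub>T\<^esub>) = \<one>\<^bsub>F\<^esub>"
  using three_field_kernel_iff[OF T.three_field_axioms F.three_field_axioms proj_hom] split_exact
  by (simp add: split_exact_def short_exact_def)

lemma proj_incl_one [simp]: "j \<in> carrier J \<Longrightarrow> \<pi> (incl E j \<one>\<^bsub>T\<^esub>) = \<one>\<^bsub>F\<^esub>"
  using incl_image[of "incl E j"] by simp

lemma proj_neg1: "\<pi> T.neg1 = F.neg1"
  by (rule three_field_hom_neg_one[OF T.three_field_axioms F.three_field_axioms proj_hom])

lemma \<iota>_closed [simp]: "j \<in> carrier J \<Longrightarrow> \<iota> j \<in> carrier T.U"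
  by simp

lemma \<iota>_eqD: "\<iota> j = \<iota> k \<Longrightarrow> j \<in> carrier J \<Longrightarrow> k \<in> carrier J \<Longrightarrow> j = k"
  using T.Q_eqI[of "incl E j" "incl E k"] incl_inj by (auto dest: inj_onD)

lemma \<iota>_add: "j \<in> carrier J \<Longrightarrow> k \<in> carrier J \<Longrightarrow> \<iota> (j \<oplus>\<^bsub>J\<^esub> k) = \<iota> j \<oplus>\<^bsub>T.U\<^esub> \<iota> k"
  using nonunital_ring_homD(3)[OF incl_hom] T.Q_add by simp

lemma \<iota>_mult: "j \<in> carrier J \<Longrightarrow> k \<in> carrier J \<Longrightarrow> \<iota> (j \<otimes>\<^bsub>J\<^esub> k) = \<iota> j \<otimes>\<^bsub>T.U\<^esub> \<iota> k"
  using nonunital_ring_homD(2)[OF incl_hom] T.Q_mult by simp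

lemma \<iota>_zero: "\<iota> \<zero>\<^bsub>J\<^esub> = \<zero>\<^bsub>T.U\<^esub>"
  using \<iota>_add[of "\<zero>\<^bsub>J\<^esub>" "\<zero>\<^bsub>J\<^esub>"] \<iota>_closed[of "\<zero>\<^bsub>J\<^esub>"]
  by (metis J.l_zero J.zero_closed T.U.add.l_cancel_one)

lemma \<iota>_minus: "j \<in> carrier J \<Longrightarrow> \<iota> (\<ominus>\<^bsub>J\<^esub> j) = \<ominus>\<^bsub>T.U\<^esub> \<iota> j"
  using \<iota>_add[of "\<ominus>\<^bsub>J\<^esub> j" j]
  by (intro T.U.minus_equality[symmetric]) (simp_all add: J.l_neg \<iota>_zero)

text \<open>Exactness in the form used below: a unit \<open>w\<close> lying over 1 is
  \<open>1 + j\<close> with \<open>j\<close> in the ideal, since \<open>w - 1\<close> is a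
  translation in the kernel.\<close>

lemma \<iota>_ex:
  assumes "w \<in> carrier T" "\<pi> w = \<one>\<^bsub>F\<^esub>"
  obtains j where "j \<in> carrier J" "\<iota> j = (False, w)"
proof -
  have "q T w T.neg1 \<in> incl E ` carrier J"
    using T.Q_ex[OF assms(1)] assms(2) incl_image by simp
  then show ?thesis using that T.Q_ex(2)[OF assms(1)] by auto
qed

lemma u_incl: "j \<in> carrier J \<Longrightarrow> x \<in> carrier T \<Longrightarrow> T.u (incl E j x) = T.u x \<oplus>\<^bsub>T.U\<^esub> \<iota> j"
  by (rule T.u_apply) simp_all

lemma proj_incl [simp]:
  assumes "j \<in> carrier J" "x \<in> carrier T"
  shows "\<pi> (incl E j x) = \<pi> x"
proof -
  \<comment> \<open>The morphism \<pi> is defined on units only, so \<open>x + j\<close> is written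
    as the ternary sum \<open>x + (1 + j) - 1\<close>.\<close>
  have "incl E j x = tadd T x (incl E j \<one>\<^bsub>T\<^esub>) T.neg1"
    using u_incl[OF assms] assms T.tadd_perm(2) by (simp add: T.local_add_eq)
  then show ?thesis
    using assms F.tadd_neg_one[of "\<pi> x"] F.tadd_perm by (simp add: proj_neg1)
qed

section \<open>The action on the ideal\<close>

abbreviation A where "A \<equiv> induced_algebra E"

lemma induced_sel [simp]: "carrier A = carrier J" "add A = add J" "mult A = mult J" "zero A = zero J"
  by (simp_all add: induced_algebra_def)

text \<open>The \<open>inv_into\<close> in \<open>induced_algebra\<close> is meaningful because
  \<sigma>(f) maps the kernel into itself:
  \<open>1 + \<sigma>(f) j = \<sigma>(f) (1 + j) - \<sigma>(f) + 1\<close> is sent by \<pi> to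
  \<open>f - f + 1 = 1\<close>.\<close>

lemma smult:
  assumes f: "f \<in> carrier F" and j: "j \<in> carrier J"
  shows "f \<odot>\<^bsub>A\<^esub> j \<in> carrier J" "\<iota> (f \<odot>\<^bsub>A\<^esub> j) = T.u (\<sigma> f) \<otimes>\<^bsub>T.U\<^esub> \<iota> j"
    "incl E (f \<odot>\<^bsub>A\<^esub> j) = unit_lmult T (\<sigma> f) (incl E j)"
proof -
  let ?x = "unit_lmult T (\<sigma> f) (incl E j)"
  have x: "?x \<in> carrier (Q T)" "T.v ?x = T.u (\<sigma> f) \<otimes>\<^bsub>T.U\<^esub> \<iota> j"
    using T.unit_lmult[of "\<sigma> f" "incl E j"] f j by auto
  have "(False, ?x \<one>\<^bsub>T\<^esub>) = T.u (\<sigma> f \<otimes>\<^bsub>T\<^esub> incl E j \<one>\<^bsub>T\<^esub>) \<oplus>\<^bsub>T.U\<^esub> \<ominus>\<^bsub>T.U\<^esub> T.u (\<sigma> f)"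
    unfolding x(2) using f j T.act_minus[of "\<sigma> f" "incl E j \<one>\<^bsub>T\<^esub>"]
    by (simp add: T.u_mult T.False_eq)
  also have "\<dots> = (False, tadd T (\<sigma> f \<otimes>\<^bsub>T\<^esub> incl E j \<one>\<^bsub>T\<^esub>) (\<sigma> f \<otimes>\<^bsub>T\<^esub> T.neg1) \<one>\<^bsub>T\<^esub>)"
    using f by (simp add: T.local_add_eq flip: T.u_neg_one)
  finally have "?x \<one>\<^bsub>T\<^esub> = tadd T (\<sigma> f \<otimes>\<^bsub>T\<^esub> incl E j \<one>\<^bsub>T\<^esub>) (\<sigma> f \<otimes>\<^bsub>T\<^esub> T.neg1) \<one>\<^bsub>T\<^esub>"
    by simp
  then have "\<pi> (?x \<one>\<^bsub>T\<^esub>) = tadd F f (f \<otimes>\<^bsub>F\<^esub> F.neg1) \<one>\<^bsub>F\<^esub>"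
    using f j by (simp add: proj_neg1)
  also have "\<dots> = \<one>\<^bsub>F\<^esub>"
  proof -
    have "F.u (tadd F f (f \<otimes>\<^bsub>F\<^esub> F.neg1) \<one>\<^bsub>F\<^esub>) = F.u \<one>\<^bsub>F\<^esub>"
      using f by (simp add: F.u_tadd F.u_neg_one F.U.r_neg)
    then show ?thesis by simp
  qed
  finally have "?x \<in> incl E ` carrier J"
    using x incl_image by simp
  then show "f \<odot>\<^bsub>A\<^esub> j \<in> carrier J" "incl E (f \<odot>\<^bsub>A\<^esub> j) = ?x"
    by (simp_all add: induced_algebra_def inv_into_into f_inv_into_f)
  then show "\<iota> (f \<odot>\<^bsub>A\<^esub> j) = T.u (\<sigma> f) \<otimes>\<^bsub>T.U\<^esub> \<iota> j"
    using x by simp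
qed

end

section \<open>Sections that commute with the ideal\<close>

locale commuting_split_extension = split_extension +
  assumes section_commutes: "section_commutes F E"
begin

lemma \<iota>_comm:
  assumes "f \<in> carrier F" "j \<in> carrier J"
  shows "\<iota> j \<otimes>\<^bsub>T.U\<^esub> T.u (\<sigma> f) = T.u (\<sigma> f) \<otimes>\<^bsub>T.U\<^esub> \<iota> j"
proof -
  have "unit_lmult T (\<sigma> f) (incl E j) = unit_rmult T (incl E j) (\<sigma> f)"
    using section_commutes assms by (simp add: section_commutes_def)
  then show ?thesis
    using T.unit_lmult(2)[of "\<sigma> f" "incl E j"] T.unit_rmult(2)[of "\<sigma> f" "incl E j"] assms by simp
qed

lemma induced_quasi_inverse:
  assumes a: "a \<in> carrier J"
  shows "\<exists>a'\<in>carrier J. a \<otimes>\<^bsub>J\<^esub> a' = a \<oplus>\<^bsub>J\<^esub> a'"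
proof -
  define w where "w = incl E (\<ominus>\<^bsub>J\<^esub> a) \<one>\<^bsub>T\<^esub>"
  have w: "w \<in> carrier T" "\<pi> w = \<one>\<^bsub>F\<^esub>" "T.u w = \<one>\<^bsub>T.U\<^esub> \<oplus>\<^bsub>T.U\<^esub> \<ominus>\<^bsub>T.U\<^esub> \<iota> a"
    using a u_incl[of "\<ominus>\<^bsub>J\<^esub> a" "\<one>\<^bsub>T\<^esub>"] by (simp_all add: w_def \<iota>_minus T.local_one)
  define w' where "w' = inv\<^bsub>T\<^esub> w"
  have w': "w' \<in> carrier T" "w \<otimes>\<^bsub>T\<^esub> w' = \<one>\<^bsub>T\<^esub>" using w by (simp_all add: w'_def)
  \<comment> \<open>Since \<open>w = 1 - a\<close> lies over 1, so does its inverse; this is what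
    makes the inverse \<open>1 + c\<close> with \<open>c\<close> in the ideal.\<close>
  have "\<pi> w' = \<pi> (w \<otimes>\<^bsub>T\<^esub> w')" using w w' by (subst proj_simps) simp_all
  then have "\<pi> w' = \<one>\<^bsub>F\<^esub>" using w'(2) by simp
  then obtain c where c: "c \<in> carrier J" "\<iota> c = (False, w')" using \<iota>_ex w' by blast
  then have uw': "T.u w' = \<one>\<^bsub>T.U\<^esub> \<oplus>\<^bsub>T.U\<^esub> \<iota> c"
    using w' by (simp add: T.False_eq T.U.a_ac T.U.r_neg)
  have "\<one>\<^bsub>T.U\<^esub> = (\<one>\<^bsub>T.U\<^esub> \<oplus>\<^bsub>T.U\<^esub> \<ominus>\<^bsub>T.U\<^esub> \<iota> a) \<otimes>\<^bsub>T.U\<^esub> (\<one>\<^bsub>T.U\<^esub> \<oplus>\<^bsub>T.U\<^esub> \<iota> c)"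
    using T.u_mult_u[of w w'] w' w(3) uw' by (simp add: T.local_one)
  also have "\<dots> = \<one>\<^bsub>T.U\<^esub> \<oplus>\<^bsub>T.U\<^esub> (\<iota> c \<oplus>\<^bsub>T.U\<^esub> \<ominus>\<^bsub>T.U\<^esub> (\<iota> a \<oplus>\<^bsub>T.U\<^esub> \<iota> a \<otimes>\<^bsub>T.U\<^esub> \<iota> c))"
    using a c(1) by (simp add: T.U.l_distr T.U.r_distr T.U.l_minus T.U.minus_add T.U.a_ac del: T.local_carrier)
  finally have "\<iota> c \<oplus>\<^bsub>T.U\<^esub> \<ominus>\<^bsub>T.U\<^esub> (\<iota> a \<oplus>\<^bsub>T.U\<^esub> \<iota> a \<otimes>\<^bsub>T.U\<^esub> \<iota> c) = \<zero>\<^bsub>T.U\<^esub>"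
    using a c(1) by (simp add: T.U.add.r_cancel_one del: T.local_carrier)
  then have "\<iota> c = \<iota> a \<oplus>\<^bsub>T.U\<^esub> \<iota> a \<otimes>\<^bsub>T.U\<^esub> \<iota> c"
    using a c(1) T.U.minus_equality[of "\<iota> c" "\<ominus>\<^bsub>T.U\<^esub> (\<iota> a \<oplus>\<^bsub>T.U\<^esub> \<iota> a \<otimes>\<^bsub>T.U\<^esub> \<iota> c)"]
    by (simp add: T.U.minus_minus del: T.local_carrier)
  then have "\<iota> c = \<iota> (a \<oplus>\<^bsub>J\<^esub> a \<otimes>\<^bsub>J\<^esub> c)"
    using a c(1) by (simp add: \<iota>_add \<iota>_mult J.m_closed)
  then have eq: "c = a \<oplus>\<^bsub>J\<^esub> a \<otimes>\<^bsub>J\<^esub> c"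
    using \<iota>_eqD a c(1) J.m_closed by simp
  \<comment> \<open>Expanding \<open>(1 - a) (1 + c) = 1\<close> gave \<open>c = a + ac\<close>.
    Hence \<open>a (-c) = -ac = a - c\<close>, and \<open>-c\<close> is the quasi-inverse.\<close>
  have "a \<otimes>\<^bsub>J\<^esub> (\<ominus>\<^bsub>J\<^esub> c) = \<ominus>\<^bsub>J\<^esub> (a \<otimes>\<^bsub>J\<^esub> c)"
    using a c(1) by (rule J.r_minus)
  also have "\<dots> = a \<oplus>\<^bsub>J\<^esub> \<ominus>\<^bsub>J\<^esub> (a \<oplus>\<^bsub>J\<^esub> a \<otimes>\<^bsub>J\<^esub> c)"
    using a c(1) J.m_closed by (simp add: J.minus_add J.r_neg2)
  finally show ?thesis
    using a c(1) eq by (intro bexI[where x = "\<ominus>\<^bsub>J\<^esub> c"]) simp_all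
qed

text \<open>Because \<iota> is injective on the ideal, each algebra axiom may be checked in the
  local ring, where scalars are left factors \<sigma>(f). The laws in which a scalar has to pass an
  element of the ideal come from \<open>\<iota>_comm\<close>.\<close>

lemma induced_Q_algebra: "Q_algebra F A"
proof (intro Q_algebra.intro three_field_algebra.intro Q_algebra_axioms.intro)
  show "unital_three_field F" by (rule F.unital_three_field_axioms)
  show "nonunital_ring A"
    using J.nonunital_ring_axioms by (rule nonunital_ring_cong) simp_all
next
  fix f a b assume *: "f \<in> carrier F" "a \<in> carrier A" "b \<in> carrier A"
  show "f \<odot>\<^bsub>A\<^esub> (a \<oplus>\<^bsub>A\<^esub> b) = f \<odot>\<^bsub>A\<^esub> a \<oplus>\<^bsub>A\<^esub> f \<odot>\<^bsub>A\<^esub> b"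
    using * by (intro \<iota>_eqD) (simp_all add: smult(1,2) \<iota>_add T.U.r_distr)
  show "f \<odot>\<^bsub>A\<^esub> (a \<otimes>\<^bsub>A\<^esub> b) = f \<odot>\<^bsub>A\<^esub> a \<otimes>\<^bsub>A\<^esub> b"
    using * by (intro \<iota>_eqD) (simp_all add: smult(1,2) \<iota>_mult J.m_closed T.U.m_assoc)
  show "f \<odot>\<^bsub>A\<^esub> (a \<otimes>\<^bsub>A\<^esub> b) = a \<otimes>\<^bsub>A\<^esub> (f \<odot>\<^bsub>A\<^esub> b)"
    using *
    by (intro \<iota>_eqD) (simp_all add: smult(1,2) \<iota>_mult J.m_closed \<iota>_comm flip: T.U.m_assoc)
next
  fix f g a assume *: "f \<in> carrier F" "g \<in> carrier F" "a \<in> carrier A"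
  show "(f \<otimes>\<^bsub>F\<^esub> g) \<odot>\<^bsub>A\<^esub> a = f \<odot>\<^bsub>A\<^esub> (g \<odot>\<^bsub>A\<^esub> a)"
    using * by (intro \<iota>_eqD) (simp_all add: smult(1,2) T.u_mult_u T.U.m_assoc)
  \<comment> \<open>Scalars commute on the ideal even if \<sigma>(f) and \<sigma>(g) do not:
    \<sigma>(g) is moved to the right of \<open>a\<close>, and then to the left past the element
    \<open>f.a\<close> of the ideal.\<close>
  have "\<iota> (f \<odot>\<^bsub>A\<^esub> (g \<odot>\<^bsub>A\<^esub> a)) = \<iota> (f \<odot>\<^bsub>A\<^esub> a) \<otimes>\<^bsub>T.U\<^esub> T.u (\<sigma> g)"
    using * by (simp add: smult(1,2) \<iota>_comm[symmetric, of g a] T.U.m_assoc)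
  then show "f \<odot>\<^bsub>A\<^esub> (g \<odot>\<^bsub>A\<^esub> a) = g \<odot>\<^bsub>A\<^esub> (f \<odot>\<^bsub>A\<^esub> a)"
    using * \<iota>_comm[of g "f \<odot>\<^bsub>A\<^esub> a"] by (intro \<iota>_eqD) (simp_all add: smult(1,2))
next
  fix f g h a assume *: "f \<in> carrier F" "g \<in> carrier F" "h \<in> carrier F" "a \<in> carrier A"
  show "tadd F f g h \<odot>\<^bsub>A\<^esub> a = f \<odot>\<^bsub>A\<^esub> a \<oplus>\<^bsub>A\<^esub> g \<odot>\<^bsub>A\<^esub> a \<oplus>\<^bsub>A\<^esub> h \<odot>\<^bsub>A\<^esub> a"
    using * by (intro \<iota>_eqD) (simp_all add: smult(1,2) F.tadd_closed \<iota>_add T.u_tadd T.U.l_distr)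
next
  fix a assume "a \<in> carrier A"
  then show "\<one>\<^bsub>F\<^esub> \<odot>\<^bsub>A\<^esub> a = a"
    by (intro \<iota>_eqD) (simp_all add: smult(1,2) flip: T.local_one)
qed (simp_all add: smult(1) induced_quasi_inverse)

section \<open>The semi-direct product as a unitization\<close>

lemma u_semidirect:
  "f \<in> carrier F \<Longrightarrow> j \<in> carrier J \<Longrightarrow> T.u (incl E j (\<sigma> f)) = T.u (\<sigma> f) \<oplus>\<^bsub>T.U\<^esub> \<iota> j"
  by (simp add: u_incl)

lemma semidirect_mult:
  assumes f: "f \<in> carrier F" "g \<in> carrier F" and j: "j \<in> carrier J" "k \<in> carrier J"
  shows "incl E (f \<odot>\<^bsub>A\<^esub> k \<oplus>\<^bsub>J\<^esub> g \<odot>\<^bsub>A\<^esub> j \<oplus>\<^bsub>J\<^esub> j \<otimes>\<^bsub>J\<^esub> k) (\<sigma> (f \<otimes>\<^bsub>F\<^esub> g)) =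
    incl E j (\<sigma> f) \<otimes>\<^bsub>T\<^esub> incl E k (\<sigma> g)" (is "?l = ?r")
proof -
  \<comment> \<open>\<open>\<iota>_comm\<close> turns the summand coming from \<open>g.j\<close>
    into \<open>j \<sigma>(g)\<close>, which is the cross term of the expanded product on the
    right.\<close>
  have "T.u ?l = T.u (\<sigma> f) \<otimes>\<^bsub>T.U\<^esub> T.u (\<sigma> g) \<oplus>\<^bsub>T.U\<^esub>
      (T.u (\<sigma> f) \<otimes>\<^bsub>T.U\<^esub> \<iota> k \<oplus>\<^bsub>T.U\<^esub> \<iota> j \<otimes>\<^bsub>T.U\<^esub> T.u (\<sigma> g) \<oplus>\<^bsub>T.U\<^esub> \<iota> j \<otimes>\<^bsub>T.U\<^esub> \<iota> k)"
    using assms by (subst u_semidirect) (simp_all add: \<iota>_add \<iota>_mult smult(1,2) J.m_closed \<iota>_comm T.u_mult_u)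
  also have "\<dots> = T.u ?r"
    using assms
    by (simp add: T.u_mult_u u_semidirect T.U.l_distr T.U.r_distr T.U.a_ac)
  finally show ?thesis by simp
qed

lemma semidirect_tadd:
  assumes f: "f \<in> carrier F" "g \<in> carrier F" "h \<in> carrier F"
    and j: "j \<in> carrier J" "k \<in> carrier J" "l \<in> carrier J"
  shows "incl E (j \<oplus>\<^bsub>J\<^esub> k \<oplus>\<^bsub>J\<^esub> l) (\<sigma> (tadd F f g h)) =
    tadd T (incl E j (\<sigma> f)) (incl E k (\<sigma> g)) (incl E l (\<sigma> h))" (is "?l = ?r")
proof -
  have "T.u ?l = T.u ?r"
    using assms by (simp add: T.u_tadd u_semidirect \<iota>_add F.tadd_closed T.U.a_ac del: sect_simps)
      (simp add: T.u_tadd u_semidirect T.U.a_ac)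
  then show ?thesis by simp
qed

lemma semidirect_bij: "bij_betw (\<lambda>(f, j). incl E j (\<sigma> f)) (carrier F \<times> carrier J) (carrier T)"
  unfolding bij_betw_def
proof (intro conjI equalityI subsetI inj_onI)
  fix x y assume *: "x \<in> carrier F \<times> carrier J" "y \<in> carrier F \<times> carrier J"
    "(case x of (f, j) \<Rightarrow> incl E j (\<sigma> f)) = (case y of (f, j) \<Rightarrow> incl E j (\<sigma> f))"
  obtain f j where x: "x = (f, j)" "f \<in> carrier F" "j \<in> carrier J" using *(1) by auto
  obtain g k where y: "y = (g, k)" "g \<in> carrier F" "k \<in> carrier J" using *(2) by auto
  have eq: "incl E j (\<sigma> f) = incl E k (\<sigma> g)" using * x y by simp
  then have "\<pi> (incl E j (\<sigma> f)) = \<pi> (incl E k (\<sigma> g))" by simp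
  then have "f = g" using x y by simp
  then have "T.u (\<sigma> f) \<oplus>\<^bsub>T.U\<^esub> \<iota> j = T.u (\<sigma> f) \<oplus>\<^bsub>T.U\<^esub> \<iota> k"
    using eq u_semidirect[OF x(2,3)] u_semidirect[OF y(2,3)] by simp
  then have "\<iota> j = \<iota> k"
    by (rule T.U.add_left_imp_eq) (use x y in simp_all)
  then show "x = y" using x y \<open>f = g\<close> \<iota>_eqD by blast
next
  fix x assume x: "x \<in> carrier T"
  define f where "f = \<pi> x"
  have f: "f \<in> carrier F" using x by (simp add: f_def)
  \<comment> \<open>The ideal component of \<open>x\<close> has to be
    \<open>x - \<sigma>(\<pi> x)\<close>. Adding 1 gives a unit \<open>w\<close> lying over 1, to
    which \<open>\<iota>_ex\<close> applies.\<close>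
  define w where "w = tadd T x (\<sigma> f \<otimes>\<^bsub>T\<^esub> T.neg1) \<one>\<^bsub>T\<^esub>"
  have w: "w \<in> carrier T" using x f by (simp add: w_def T.tadd_closed)
  have "F.u (\<pi> w) = F.u \<one>\<^bsub>F\<^esub>"
    using x f by (simp add: w_def proj_neg1 F.u_tadd F.u_neg_one F.U.r_neg flip: f_def)
  then obtain j where j: "j \<in> carrier J" "\<iota> j = (False, w)" using \<iota>_ex w by blast
  have "T.u (incl E j (\<sigma> f)) = T.u (\<sigma> f) \<oplus>\<^bsub>T.U\<^esub> (T.u w \<oplus>\<^bsub>T.U\<^esub> \<ominus>\<^bsub>T.U\<^esub> \<one>\<^bsub>T.U\<^esub>)"
    using f j w by (simp only: u_semidirect T.False_eq)
  also have "\<dots> = T.u x"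
    using f x by (simp add: w_def T.u_tadd T.u_neg_one T.U.a_ac T.U.r_neg T.U.r_neg1 T.U.r_neg2 flip: T.local_one)
  finally show "x \<in> (\<lambda>(f, j). incl E j (\<sigma> f)) ` (carrier F \<times> carrier J)"
    using f j by (auto intro!: image_eqI[where x="(f, j)"])
qed auto

lemma unitization_iso: "(\<lambda>(f, j). incl E j (\<sigma> f)) \<in> three_field_iso (unitization F A) T"
  using semidirect_bij semidirect_mult semidirect_tadd
  by (auto simp: three_field_iso_def three_field_hom_def hom_def unitization_def)

end

section \<open>The unitization\<close>

lemma unitization_sel [simp]:
  "carrier (unitization F A) = carrier F \<times> carrier A"
  "(f1, a1) \<otimes>\<^bsub>unitization F A\<^esub> (f2, a2) =
     (f1 \<otimes>\<^bsub>F\<^esub> f2, f1 \<odot>\<^bsub>A\<^esub> a2 \<oplus>\<^bsub>A\<^esub> f2 \<odot>\<^bsub>A\<^esub> a1 \<oplus>\<^bsub>A\<^esub> a1 \<otimes>\<^bsub>A\<^esub> a2)"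
  "\<one>\<^bsub>unitization F A\<^esub> = (\<one>\<^bsub>F\<^esub>, \<zero>\<^bsub>A\<^esub>)"
  "tadd (unitization F A) (f1, a1) (f2, a2) (f3, a3) =
     (tadd F f1 f2 f3, a1 \<oplus>\<^bsub>A\<^esub> a2 \<oplus>\<^bsub>A\<^esub> a3)"
  by (simp_all add: unitization_def)

lemma unitization_extension_sel [simp]:
  "carrier (ideal_part (unitization_extension F A)) = carrier A"
  "mult (ideal_part (unitization_extension F A)) = mult A"
  "add (ideal_part (unitization_extension F A)) = add A"
  "zero (ideal_part (unitization_extension F A)) = zero A"
  "total (unitization_extension F A) = unitization F A"
  "proj (unitization_extension F A) x = fst x"
  "sect (unitization_extension F A) f = (f, \<zero>\<^bsub>A\<^esub>)"
  "f \<in> carrier F \<Longrightarrow> b \<in> carrier A \<Longrightarrow>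
     incl (unitization_extension F A) a (f, b) = (f, b \<oplus>\<^bsub>A\<^esub> a)"
  by (simp_all add: unitization_extension_def case_prod_beta)

context Q_algebra
begin

sublocale F: three_field F
  using base_field by (rule three_field.intro)

sublocale A: nonunital_ring A
  by (rule algebra_ring)

section \<open>The unitization is a 3-field\<close>

abbreviation W where "W \<equiv> unitization F A"
abbreviation E where "E \<equiv> unitization_extension F A"

lemma smult_zero [simp]: "f \<in> carrier F \<Longrightarrow> f \<odot> \<zero> = \<zero>"
  using smult_add[of f \<zero> \<zero>] smult_closed[of f \<zero>] by simp

lemmas alg_simps = smult_closed smult_add mult_smult one_smult A.m_closed A.m_assoc A.l_distr A.r_distr

text \<open>For factors \<open>(f, a)\<close>, \<open>(g, b)\<close>, \<open>(h, c)\<close> the two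
  bracketings differ in terms such as \<open>h (f b)\<close> against \<open>f (h b)\<close>,
  \<open>h (ab)\<close> against \<open>a (hb)\<close> and \<open>(ga) c\<close> against
  \<open>a (gc)\<close>. Commuting scalars and bilinearity of the product match them.\<close>

lemma unitization_monoid: "monoid W"
proof (rule monoidI)
  fix x y z assume "x \<in> carrier W" "y \<in> carrier W" "z \<in> carrier W"
  then show "x \<otimes>\<^bsub>W\<^esub> y \<otimes>\<^bsub>W\<^esub> z = x \<otimes>\<^bsub>W\<^esub> (y \<otimes>\<^bsub>W\<^esub> z)"
    by (auto simp: alg_simps F.m_assoc A.a_ac smult_smult_comm smult_mult_left
        smult_mult_right[symmetric])
qed (auto simp: alg_simps)

text \<open>Factor \<open>(f, a) = (f, 0) (1, b)\<close>, where \<open>b\<close> is the inverse of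
  \<open>f\<close> applied to \<open>a\<close>. The first factor is inverted in \<open>F\<close>. If
  \<open>c\<close> is a quasi-inverse of \<open>-b\<close>, then \<open>-bc = -b + c\<close>, which
  says \<open>(1 + b) (1 - c) = 1\<close>, so the second factor has right inverse
  \<open>(1, -c)\<close>.\<close>

lemma unitization_r_inv:
  assumes "x \<in> carrier W"
  shows "\<exists>y\<in>carrier W. x \<otimes>\<^bsub>W\<^esub> y = \<one>\<^bsub>W\<^esub>"
proof -
  interpret W: monoid W by (rule unitization_monoid)
  obtain f a where x: "x = (f, a)" "f \<in> carrier F" "a \<in> carrier A" using assms by auto
  define b where "b = inv\<^bsub>F\<^esub> f \<odot> a"
  have b: "b \<in> carrier A" using x by (simp add: b_def smult_closed)
  obtain c where c: "c \<in> carrier A" "\<ominus> b \<otimes> c = \<ominus> b \<oplus> c"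
    using quasi_inverse[of "\<ominus> b"] b by auto
  have bc: "b \<otimes> c = b \<oplus> \<ominus> c"
    using c b A.l_minus[of b c] A.m_closed[of b c] A.minus_minus[of "b \<otimes> c"]
    by (simp add: A.minus_add)
  define p r s t where "p = (f, \<zero>)" and "r = (\<one>\<^bsub>F\<^esub>, b)"
    and "s = (\<one>\<^bsub>F\<^esub>, \<ominus> c)" and "t = (inv\<^bsub>F\<^esub> f, \<zero>)"
  have W: "p \<in> carrier W" "r \<in> carrier W" "s \<in> carrier W" "t \<in> carrier W"
    using x b c by (simp_all add: p_def r_def s_def t_def)
  have "f \<odot> b = a"
    using x by (simp add: b_def one_smult flip: mult_smult)
  then have pr: "x = p \<otimes>\<^bsub>W\<^esub> r"
    using x b by (simp add: p_def r_def)
  have rs: "r \<otimes>\<^bsub>W\<^esub> s = \<one>\<^bsub>W\<^esub>"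
    using b c(1) bc
    by (simp add: r_def s_def one_smult A.r_minus A.minus_add A.a_ac A.r_neg A.r_neg1 A.r_neg2)
  have pt: "p \<otimes>\<^bsub>W\<^esub> t = \<one>\<^bsub>W\<^esub>"
    using x by (simp add: p_def t_def)
  have "x \<otimes>\<^bsub>W\<^esub> (s \<otimes>\<^bsub>W\<^esub> t) = p \<otimes>\<^bsub>W\<^esub> ((r \<otimes>\<^bsub>W\<^esub> s) \<otimes>\<^bsub>W\<^esub> t)"
    unfolding pr using W by (simp only: W.m_assoc W.m_closed)
  also have "\<dots> = \<one>\<^bsub>W\<^esub>"
    unfolding rs W.l_one[OF W(4)] by (rule pt)
  finally show ?thesis
    using W by (blast intro: W.m_closed)
qed

text \<open>The quasi-inverse condition is one-sided and yields right inverses. These are two-sided: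
  a right inverse \<open>y\<close> of \<open>x\<close> has a right inverse \<open>z\<close> of its
  own, and then \<open>x = x (y z) = (x y) z = z\<close>.\<close>

lemma unitization_group: "group W"
proof -
  interpret W: monoid W by (rule unitization_monoid)
  show ?thesis
  proof (rule W.group_l_invI)
    fix x assume x: "x \<in> carrier W"
    obtain y where y: "y \<in> carrier W" "x \<otimes>\<^bsub>W\<^esub> y = \<one>\<^bsub>W\<^esub>" using unitization_r_inv[OF x] by blast
    obtain z where z: "z \<in> carrier W" "y \<otimes>\<^bsub>W\<^esub> z = \<one>\<^bsub>W\<^esub>" using unitization_r_inv[OF y(1)] by blast
    have "x = z" using W.inv_unique[OF y(2) z(2) y(1) x z(1)] .
    then show "\<exists>y\<in>carrier W. y \<otimes>\<^bsub>W\<^esub> x = \<one>\<^bsub>W\<^esub>" using y z by blast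
  qed
qed

lemma unitization_unital: "unital_three_field W"
proof (rule unital_three_field.intro[OF unitization_group], unfold_locales)
  fix x assume "x \<in> carrier W"
  then obtain f a where x: "x = (f, a)" "f \<in> carrier F" "a \<in> carrier A" by auto
  obtain f' where f': "f' \<in> carrier F" "\<And>b. b \<in> carrier F \<Longrightarrow> tadd F f f' b = b"
    using F.querelement[OF x(2)] by blast
  show "\<exists>y\<in>carrier W. \<forall>b\<in>carrier W. tadd W x y b = b"
    using x f' by (intro bexI[where x = "(f', \<ominus> a)"]) (auto simp: A.r_neg)
next
  fix x y z w assume "x \<in> carrier W" "y \<in> carrier W" "z \<in> carrier W" "w \<in> carrier W"
  then show "w \<otimes>\<^bsub>W\<^esub> tadd W x y z = tadd W (w \<otimes>\<^bsub>W\<^esub> x) (w \<otimes>\<^bsub>W\<^esub> y) (w \<otimes>\<^bsub>W\<^esub> z)"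
    and "tadd W x y z \<otimes>\<^bsub>W\<^esub> w = tadd W (x \<otimes>\<^bsub>W\<^esub> w) (y \<otimes>\<^bsub>W\<^esub> w) (z \<otimes>\<^bsub>W\<^esub> w)"
    by (auto simp: alg_simps tadd_smult F.tadd_closed F.distrib_left F.distrib_right A.a_ac)
qed (auto simp: F.tadd_closed A.a_ac intro: F.tadd_assoc1 F.tadd_assoc2 F.tadd_comm12 F.tadd_comm23)

sublocale W: three_field W
  using unitization_unital by (rule three_field.intro)

section \<open>The algebra inside the local ring of its unitization\<close>

abbreviation \<iota> where "\<iota> a \<equiv> W.v (incl E a)"

text \<open>The element \<open>(0, a)\<close> is the sum of the units \<open>(1, a)\<close> and
  \<open>(-1, 0)\<close>, which exhibits the map \<open>incl E a\<close> as a translation of the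
  unitization.\<close>

lemma incl_q:
  assumes "a \<in> carrier A"
  shows "incl E a = q W (\<one>\<^bsub>F\<^esub>, a) (F.neg1, \<zero>)"
proof -
  have "tadd F f \<one>\<^bsub>F\<^esub> F.neg1 = f" if "f \<in> carrier F" for f
    using F.tadd_neg_one F.tadd_perm that by simp
  then show ?thesis
    using assms by (auto simp: q_def unitization_extension_def intro!: restrict_ext)
qed

lemma incl_closed [simp]: "a \<in> carrier A \<Longrightarrow> incl E a \<in> carrier (Q W)"
  by (simp add: incl_q)

lemma incl_one [simp]: "a \<in> carrier A \<Longrightarrow> incl E a (\<one>\<^bsub>F\<^esub>, \<zero>) = (\<one>\<^bsub>F\<^esub>, a)"
  by simp

lemma \<iota>_closed [simp]: "a \<in> carrier A \<Longrightarrow> \<iota> a \<in> carrier W.U"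
  by simp

lemma u_pair: "f \<in> carrier F \<Longrightarrow> a \<in> carrier A \<Longrightarrow> W.u (f, a) = W.u (f, \<zero>) \<oplus>\<^bsub>W.U\<^esub> \<iota> a"
  using W.u_apply[OF incl_closed, of a "(f, \<zero>)"] by simp

lemma u_one_pair: "a \<in> carrier A \<Longrightarrow> W.u (\<one>\<^bsub>F\<^esub>, a) = \<one>\<^bsub>W.U\<^esub> \<oplus>\<^bsub>W.U\<^esub> \<iota> a"
  using u_pair[of "\<one>\<^bsub>F\<^esub>" a] by (simp add: W.local_one)

lemma incl_add:
  assumes "a \<in> carrier A" "b \<in> carrier A"
  shows "incl E (a \<oplus> b) = incl E a \<oplus>\<^bsub>Q W\<^esub> incl E b"
  using assms
  by (auto simp: Q_def unitization_extension_def compose_def A.a_ac intro!: restrict_ext)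

lemma \<iota>_add: "a \<in> carrier A \<Longrightarrow> b \<in> carrier A \<Longrightarrow> \<iota> (a \<oplus> b) = \<iota> a \<oplus>\<^bsub>W.U\<^esub> \<iota> b"
  unfolding incl_add by (rule W.Q_add) simp_all

text \<open>The product of the unitization is given on units only, so \<open>(1, a) (1, b)\<close>
  is computed twice, by its defining formula and as \<open>(1 + a) (1 + b)\<close> in the local
  ring. Cancelling \<open>1 + b + a\<close> leaves the claim.\<close>

lemma \<iota>_mult:
  assumes a: "a \<in> carrier A" and b: "b \<in> carrier A"
  shows "\<iota> (a \<otimes> b) = \<iota> a \<otimes>\<^bsub>W.U\<^esub> \<iota> b"
proof -
  have "W.u ((\<one>\<^bsub>F\<^esub>, a) \<otimes>\<^bsub>W\<^esub> (\<one>\<^bsub>F\<^esub>, b)) = \<one>\<^bsub>W.U\<^esub> \<oplus>\<^bsub>W.U\<^esub> (\<iota> b \<oplus>\<^bsub>W.U\<^esub> \<iota> a \<oplus>\<^bsub>W.U\<^esub> \<iota> (a \<otimes> b))"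
    using a b by (simp only: unitization_sel(2) F.l_one F.one_closed one_smult u_one_pair A.add.m_closed
        A.m_closed \<iota>_add)
  moreover have "W.u ((\<one>\<^bsub>F\<^esub>, a) \<otimes>\<^bsub>W\<^esub> (\<one>\<^bsub>F\<^esub>, b)) =
      \<one>\<^bsub>W.U\<^esub> \<oplus>\<^bsub>W.U\<^esub> (\<iota> b \<oplus>\<^bsub>W.U\<^esub> \<iota> a \<oplus>\<^bsub>W.U\<^esub> \<iota> a \<otimes>\<^bsub>W.U\<^esub> \<iota> b)"
    unfolding W.u_mult_u u_one_pair[OF a] u_one_pair[OF b] using \<iota>_closed[OF a] \<iota>_closed[OF b]
    by (simp add: W.U.l_distr W.U.r_distr W.U.a_ac del: W.local_carrier)
  ultimately have "\<one>\<^bsub>W.U\<^esub> \<oplus>\<^bsub>W.U\<^esub> (\<iota> b \<oplus>\<^bsub>W.U\<^esub> \<iota> a \<oplus>\<^bsub>W.U\<^esub> \<iota> (a \<otimes> b)) =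
      \<one>\<^bsub>W.U\<^esub> \<oplus>\<^bsub>W.U\<^esub> (\<iota> b \<oplus>\<^bsub>W.U\<^esub> \<iota> a \<oplus>\<^bsub>W.U\<^esub> \<iota> a \<otimes>\<^bsub>W.U\<^esub> \<iota> b)" by simp
  note W.U.add_left_imp_eq[OF this]
  then have "(\<iota> b \<oplus>\<^bsub>W.U\<^esub> \<iota> a) \<oplus>\<^bsub>W.U\<^esub> \<iota> (a \<otimes> b) = (\<iota> b \<oplus>\<^bsub>W.U\<^esub> \<iota> a) \<oplus>\<^bsub>W.U\<^esub> \<iota> a \<otimes>\<^bsub>W.U\<^esub> \<iota> b"
    using a b A.m_closed \<iota>_closed by (simp only: W.one_in W.U.add.m_closed W.U.m_closed)
  then show ?thesis
    by (rule W.U.add_left_imp_eq) (use a b A.m_closed \<iota>_closed in \<open>simp_all only: W.U.add.m_closed W.U.m_closed\<close>)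
qed

text \<open>The unit \<open>(f, fa)\<close> factors both as \<open>(f, 0) (1, a)\<close> and as
  \<open>(1, a) (f, 0)\<close>. Expanding \<open>1 + a\<close> and cancelling \<open>(f, 0)\<close>
  gives one equation for each order; together they make the section commute with the ideal.\<close>

lemma \<iota>_smult:
  assumes f: "f \<in> carrier F" and a: "a \<in> carrier A"
  shows "\<iota> (f \<odot> a) = W.u (f, \<zero>) \<otimes>\<^bsub>W.U\<^esub> \<iota> a" "\<iota> (f \<odot> a) = \<iota> a \<otimes>\<^bsub>W.U\<^esub> W.u (f, \<zero>)"
proof -
  have u: "W.u (f, \<zero>) \<in> carrier W.U" using f by simp
  have *: "W.u (f, f \<odot> a) = W.u (f, \<zero>) \<oplus>\<^bsub>W.U\<^esub> \<iota> (f \<odot> a)"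
    using f a by (intro u_pair) (simp_all add: smult_closed)
  have l: "(f, f \<odot> a) = (f, \<zero>) \<otimes>\<^bsub>W\<^esub> (\<one>\<^bsub>F\<^esub>, a)" and r: "(f, f \<odot> a) = (\<one>\<^bsub>F\<^esub>, a) \<otimes>\<^bsub>W\<^esub> (f, \<zero>)"
    using f a by (simp_all add: smult_closed)
  have "W.u (f, f \<odot> a) = W.u (f, \<zero>) \<oplus>\<^bsub>W.U\<^esub> W.u (f, \<zero>) \<otimes>\<^bsub>W.U\<^esub> \<iota> a"
    unfolding l W.u_mult_u u_one_pair[OF a] using u \<iota>_closed[OF a]
    by (simp only: W.U.r_distr W.one_in W.U.r_one)
  moreover have "W.u (f, f \<odot> a) = W.u (f, \<zero>) \<oplus>\<^bsub>W.U\<^esub> \<iota> a \<otimes>\<^bsub>W.U\<^esub> W.u (f, \<zero>)"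
    unfolding r W.u_mult_u u_one_pair[OF a] using u \<iota>_closed[OF a]
    by (simp only: W.U.l_distr W.one_in W.U.l_one)
  ultimately show "\<iota> (f \<odot> a) = W.u (f, \<zero>) \<otimes>\<^bsub>W.U\<^esub> \<iota> a" "\<iota> (f \<odot> a) = \<iota> a \<otimes>\<^bsub>W.U\<^esub> W.u (f, \<zero>)"
    unfolding * using u \<iota>_closed[OF a] \<iota>_closed[OF smult_closed[OF f a]]
    by (blast intro: W.U.add_left_imp_eq W.U.m_closed)+
qed

lemma incl_mult: "a \<in> carrier A \<Longrightarrow> b \<in> carrier A \<Longrightarrow> incl E (a \<otimes> b) = incl E a \<otimes>\<^bsub>Q W\<^esub> incl E b"
  using W.Q_mult[of "incl E a" "incl E b"] \<iota>_mult[of a b]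
  by (intro W.Q_eqI) (simp_all only: incl_closed A.m_closed)

lemma incl_smult:
  assumes "f \<in> carrier F" "a \<in> carrier A"
  shows "incl E (f \<odot> a) = unit_lmult W (f, \<zero>) (incl E a)"
    "incl E (f \<odot> a) = unit_rmult W (incl E a) (f, \<zero>)"
proof -
  have f: "(f, \<zero>) \<in> carrier W" using assms by simp
  note lm = W.unit_lmult[OF f incl_closed[OF assms(2)]] and rm = W.unit_rmult[OF f incl_closed[OF assms(2)]]
  show "incl E (f \<odot> a) = unit_lmult W (f, \<zero>) (incl E a)"
    using \<iota>_smult(1)[OF assms] unfolding lm(2)[symmetric]
    by (rule W.Q_eqI[OF incl_closed[OF smult_closed[OF assms]] lm(1)])
  show "incl E (f \<odot> a) = unit_rmult W (incl E a) (f, \<zero>)"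
    using \<iota>_smult(2)[OF assms] unfolding rm(2)[symmetric]
    by (rule W.Q_eqI[OF incl_closed[OF smult_closed[OF assms]] rm(1)])
qed

section \<open>Exactness of the sequence of a unitization\<close>

lemma incl_inj: "inj_on (incl E) (carrier A)"
proof (rule inj_onI)
  fix a b assume "a \<in> carrier A" "b \<in> carrier A" "incl E a = incl E b"
  then show "a = b" using incl_one[of a] incl_one[of b] by (metis Pair_inject)
qed

lemma fst_hom: "proj E \<in> three_field_hom W F"
  by (auto simp: three_field_hom_def hom_def)

lemma unitization_short_exact: "short_exact F E"
  unfolding short_exact_def
proof (intro conjI)
  note kernel = three_field_kernel_iff[OF W.three_field_axioms F.three_field_axioms fst_hom]
  show "nonunital_ring (ideal_part E)"
    using A.nonunital_ring_axioms by (rule nonunital_ring_cong) simp_all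
  show "proj E ` carrier (total E) = carrier F"
    using image_iff by fastforce
  show "incl E \<in> nonunital_ring_hom (ideal_part E) (Q (total E))"
    by (rule nonunital_ring_homI) (simp_all add: incl_mult incl_add)
  show "incl E ` carrier (ideal_part E) = three_field_kernel (total E) F (proj E)"
  proof (intro equalityI subsetI)
    fix x assume "x \<in> incl E ` carrier (ideal_part E)"
    then show "x \<in> three_field_kernel (total E) F (proj E)"
      by (auto simp: kernel)
  next
    fix x assume "x \<in> three_field_kernel (total E) F (proj E)"
    then have x: "x \<in> carrier (Q W)" "fst (x (\<one>\<^bsub>F\<^esub>, \<zero>)) = \<one>\<^bsub>F\<^esub>"
      by (simp_all add: kernel)
    \<comment> \<open>A kernel element sends \<open>(1, 0)\<close> to some \<open>(1, a)\<close>, as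
      \<open>incl E a\<close> does, and translations agreeing at 1 are equal.\<close>
    have "x (\<one>\<^bsub>F\<^esub>, \<zero>) \<in> carrier W" using W.Q_apply_closed[OF x(1) W.one_closed] by simp
    then obtain a where a: "a \<in> carrier A" "x (\<one>\<^bsub>F\<^esub>, \<zero>) = (\<one>\<^bsub>F\<^esub>, a)" using x(2) by fastforce
    then have "x = incl E a" using x by (intro W.Q_eqI) simp_all
    then show "x \<in> incl E ` carrier (ideal_part E)" using a by simp
  qed
qed (use fst_hom incl_inj base_field unitization_unital in simp_all)

lemma unitization_split_exact: "split_exact F E"
  using unitization_short_exact by (auto simp: split_exact_def three_field_hom_def hom_def)

lemma unitization_section_commutes: "section_commutes F E"
  by (simp add: section_commutes_def flip: incl_smult)

lemma induced_unitization:
  assumes "f \<in> carrier F" "a \<in> carrier A"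
  shows "f \<odot>\<^bsub>induced_algebra E\<^esub> a = f \<odot> a"
  using assms incl_inj
  by (simp add: induced_algebra_def smult_closed flip: incl_smult)

end

section \<open>The correspondence\<close>

lemma extension_isoD:
  assumes "extension_iso F E D g h"
  shows "g \<in> nonunital_ring_hom (ideal_part E) (ideal_part D)"
    and "bij_betw g (carrier (ideal_part E)) (carrier (ideal_part D))"
    and "h \<in> three_field_hom (total E) (total D)"
    and "bij_betw h (carrier (total E)) (carrier (total D))"
    and "j \<in> carrier (ideal_part E) \<Longrightarrow> Q_map (total E) (total D) h (incl E j) = incl D (g j)"
    and "x \<in> carrier (total E) \<Longrightarrow> proj D (h x) = proj E x"
    and "f \<in> carrier F \<Longrightarrow> h (sect E f) = sect D f"
  using assms unfolding extension_iso_def three_field_iso_def by auto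

text \<open>Both sides are translations, hence determined by their value at 1. Compatibility with
  the inclusions, stated with \<open>Q_map\<close>, thereby becomes an equation between units, which
  is easy to invert and to compose.\<close>

lemma incl_one_iff:
  assumes "split_extension F E" "split_extension F D"
    and "h \<in> three_field_hom (total E) (total D)"
    and "j \<in> carrier (ideal_part E)" "k \<in> carrier (ideal_part D)"
  shows "Q_map (total E) (total D) h (incl E j) = incl D k \<longleftrightarrow>
    h (incl E j \<one>\<^bsub>total E\<^esub>) = incl D k \<one>\<^bsub>total D\<^esub>"
proof -
  interpret E: split_extension F E by fact
  interpret D: split_extension F D by fact
  have jk: "incl E j \<in> carrier (Q (total E))" "incl D k \<in> carrier (Q (total D))" using assms by simp_all
  note map = Q_map[OF E.T.three_field_axioms D.T.three_field_axioms assms(3) jk(1)]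
  show ?thesis
    using map jk D.T.Q_eqI[OF map(1) jk(2)] by auto
qed

lemma extension_iso_incl_one:
  assumes "split_extension F E" "split_extension F D" "extension_iso F E D g h"
    and "j \<in> carrier (ideal_part E)"
  shows "h (incl E j \<one>\<^bsub>total E\<^esub>) = incl D (g j) \<one>\<^bsub>total D\<^esub>"
  using extension_isoD(5)[OF assms(3,4)] nonunital_ring_homD(1)[OF extension_isoD(1)[OF assms(3)] assms(4)]
    incl_one_iff[OF assms(1,2) extension_isoD(3)[OF assms(3)] assms(4)] by simp

text \<open>Needed to run the canonical isomorphism from a unitization onto \<open>E\<close>
  backwards.\<close>

lemma extension_iso_sym:
  assumes "split_extension F E" "split_extension F D" "extension_iso F E D g h"
  shows "extension_iso F D E (inv_into (carrier (ideal_part E)) g) (inv_into (carrier (total E)) h)"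
    (is "extension_iso F D E ?g ?h")
proof -
  interpret E: split_extension F E by fact
  interpret D: split_extension F D by fact
  note iso = extension_isoD[OF assms(3)]
  note g = nonunital_ring_homD[OF iso(1)] and h = three_field_homD[OF iso(3)]
  have g': "?g k \<in> carrier E.J" "g (?g k) = k" if "k \<in> carrier D.J" for k
    using that iso(2) by (auto simp: bij_betw_def inv_into_into f_inv_into_f)
  have h': "?h y \<in> carrier E.T" "h (?h y) = y" if "y \<in> carrier D.T" for y
    using that iso(4) by (auto simp: bij_betw_def inv_into_into f_inv_into_f)
  have gg: "?g (g j) = j" if "j \<in> carrier E.J" for j
    using that iso(2) by (auto simp: bij_betw_def)
  have hh: "?h (h x) = x" if "x \<in> carrier E.T" for x
    using that iso(4) by (auto simp: bij_betw_def)
  have g_hom: "?g \<in> nonunital_ring_hom D.J E.J"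
  proof (rule nonunital_ring_homI)
    fix a b assume *: "a \<in> carrier D.J" "b \<in> carrier D.J"
    show "?g (a \<otimes>\<^bsub>D.J\<^esub> b) = ?g a \<otimes>\<^bsub>E.J\<^esub> ?g b"
      using * gg[of "?g a \<otimes>\<^bsub>E.J\<^esub> ?g b"] by (simp add: g g' E.J.m_closed)
    show "?g (a \<oplus>\<^bsub>D.J\<^esub> b) = ?g a \<oplus>\<^bsub>E.J\<^esub> ?g b"
      using * gg[of "?g a \<oplus>\<^bsub>E.J\<^esub> ?g b"] by (simp add: g g')
  qed (simp add: g')
  have h_hom: "?h \<in> three_field_hom D.T E.T"
    unfolding three_field_hom_def hom_def
  proof (clarsimp, intro conjI ballI funcsetI)
    fix x y assume *: "x \<in> carrier D.T" "y \<in> carrier D.T"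
    show "?h (x \<otimes>\<^bsub>D.T\<^esub> y) = ?h x \<otimes>\<^bsub>E.T\<^esub> ?h y"
      using * hh[of "?h x \<otimes>\<^bsub>E.T\<^esub> ?h y"] by (simp add: h h')
    fix z assume "z \<in> carrier D.T"
    then show "?h (tadd D.T x y z) = tadd E.T (?h x) (?h y) (?h z)"
      using * hh[of "tadd E.T (?h x) (?h y) (?h z)"] by (simp add: h h' E.T.tadd_closed)
  qed (simp add: h')
  show ?thesis
    unfolding extension_iso_def three_field_iso_def
  proof (intro conjI ballI)
    fix k assume k: "k \<in> carrier D.J"
    have "h (incl E (?g k) \<one>\<^bsub>E.T\<^esub>) = incl D k \<one>\<^bsub>D.T\<^esub>"
      using extension_iso_incl_one[OF assms g'(1)[OF k]] g'(2)[OF k] by simp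
    then have "?h (incl D k \<one>\<^bsub>D.T\<^esub>) = incl E (?g k) \<one>\<^bsub>E.T\<^esub>"
      using hh[of "incl E (?g k) \<one>\<^bsub>E.T\<^esub>"] k g' by simp
    then show "Q_map D.T E.T ?h (incl D k) = incl E (?g k)"
      using incl_one_iff[OF assms(2,1) h_hom] k g' by simp
  next
    fix x assume x: "x \<in> carrier D.T"
    then show "proj E (?h x) = proj D x" using iso(6)[of "?h x"] h' by simp
  next
    fix f assume f: "f \<in> carrier F"
    then show "?h (sect D f) = sect E f" using iso(7)[of f] hh[of "sect E f"] by simp
  qed (use g_hom h_hom bij_betw_inv_into[OF iso(2)] bij_betw_inv_into[OF iso(4)] in simp_all)
qed

lemma extension_iso_trans:
  assumes "split_extension F E" "split_extension F D" "split_extension F C"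
    and "extension_iso F E D g h" "extension_iso F D C g' h'"
  shows "extension_iso F E C (g' \<circ> g) (h' \<circ> h)"
proof -
  interpret E: split_extension F E by fact
  interpret D: split_extension F D by fact
  interpret C: split_extension F C by fact
  note iso = extension_isoD[OF assms(4)] and iso' = extension_isoD[OF assms(5)]
  note g = nonunital_ring_homD[OF iso(1)] and h = three_field_homD[OF iso(3)]
    and g' = nonunital_ring_homD[OF iso'(1)] and h' = three_field_homD[OF iso'(3)]
  have h_hom: "h' \<circ> h \<in> three_field_hom E.T C.T"
    by (auto simp: three_field_hom_def hom_def h h')
  show ?thesis
    unfolding extension_iso_def three_field_iso_def
  proof (intro conjI ballI)
    show "g' \<circ> g \<in> nonunital_ring_hom E.J C.J"
      by (rule nonunital_ring_homI) (simp_all add: g g')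
    fix j assume j: "j \<in> carrier E.J"
    have "h (incl E j \<one>\<^bsub>E.T\<^esub>) = incl D (g j) \<one>\<^bsub>D.T\<^esub>" "h' (incl D (g j) \<one>\<^bsub>D.T\<^esub>) = incl C (g' (g j)) \<one>\<^bsub>C.T\<^esub>"
      using extension_iso_incl_one[OF assms(1,2,4) j] extension_iso_incl_one[OF assms(2,3,5) g(1)[OF j]]
      by simp_all
    then show "Q_map E.T C.T (h' \<circ> h) (incl E j) = incl C ((g' \<circ> g) j)"
      using incl_one_iff[OF assms(1,3) h_hom] j g g' by simp
  qed (use h_hom bij_betw_trans[OF iso(2) iso'(2)] bij_betw_trans[OF iso(4) iso'(4)]
      in \<open>simp_all add: iso(6,7) iso'(6,7) h\<close>)
qed

text \<open>The action is visible on units through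
  \<open>\<sigma>(f) + f.j = \<sigma>(f) (1 + j)\<close>. Applying \<open>h\<close>, which respects
  products and sections, and cancelling the image of \<open>f\<close> gives
  \<open>g (f.j) = f.(g j)\<close>.\<close>

lemma algebra_isomorphic_if_extension_isomorphic:
  assumes "split_extension F E" "split_extension F D" "extension_isomorphic F E D"
  shows "algebra_isomorphic F (induced_algebra E) (induced_algebra D)"
proof -
  interpret E: split_extension F E by fact
  interpret D: split_extension F D by fact
  obtain g h where "extension_iso F E D g h" using assms(3) by (auto simp: extension_isomorphic_def)
  note gh = this and iso = extension_isoD[OF this]
  note g = nonunital_ring_homD[OF iso(1)] and h = three_field_homD[OF iso(3)]
  have h_incl: "h (incl E j x) = incl D (g j) (h x)" if j: "j \<in> carrier E.J" and x: "x \<in> carrier E.T" for j x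
  proof -
    \<comment> \<open>Again \<open>x + j = x + (1 + j) - 1\<close>: \<open>h\<close> is known to
      match \<open>g\<close> only at \<open>1 + j\<close>, and its additivity extends this to every
      unit \<open>x\<close>.\<close>
    have *: "incl E j x = tadd E.T x (incl E j \<one>\<^bsub>E.T\<^esub>) E.T.neg1"
      using E.u_incl[OF j x] j x E.T.tadd_perm(2) by (simp add: E.T.local_add_eq)
    have "incl D (g j) (h x) = tadd D.T (h x) (incl D (g j) \<one>\<^bsub>D.T\<^esub>) D.T.neg1"
      using D.u_incl[of "g j" "h x"] g h j x D.T.tadd_perm(2) by (simp add: D.T.local_add_eq)
    also have "incl D (g j) \<one>\<^bsub>D.T\<^esub> = h (incl E j \<one>\<^bsub>E.T\<^esub>)"
      using extension_iso_incl_one[OF assms(1,2) gh j] by simp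
    finally show ?thesis
      using x j three_field_hom_neg_one[OF E.T.three_field_axioms D.T.three_field_axioms iso(3)]
      by (simp add: * h)
  qed
  have "g (f \<odot>\<^bsub>E.A\<^esub> j) = f \<odot>\<^bsub>D.A\<^esub> g j" if f: "f \<in> carrier F" and j: "j \<in> carrier E.J" for f j
  proof -
    note s = E.smult(1)[OF f j] and s' = D.smult(1)[OF f g(1)[OF j]]
    have "E.T.u (incl E (f \<odot>\<^bsub>E.A\<^esub> j) (sect E f)) = E.T.u (sect E f) \<otimes>\<^bsub>E.T.U\<^esub> (\<one>\<^bsub>E.T.U\<^esub> \<oplus>\<^bsub>E.T.U\<^esub> E.\<iota> j)"
      using f j s by (simp add: E.u_incl E.smult(2) E.T.U.r_distr)
    also have "\<dots> = E.T.u (sect E f \<otimes>\<^bsub>E.T\<^esub> incl E j \<one>\<^bsub>E.T\<^esub>)"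
      using j by (simp add: E.T.u_mult_u E.u_incl E.T.local_one)
    finally have "incl E (f \<odot>\<^bsub>E.A\<^esub> j) (sect E f) = sect E f \<otimes>\<^bsub>E.T\<^esub> incl E j \<one>\<^bsub>E.T\<^esub>" by simp
    then have "h (incl E (f \<odot>\<^bsub>E.A\<^esub> j) (sect E f)) = h (sect E f \<otimes>\<^bsub>E.T\<^esub> incl E j \<one>\<^bsub>E.T\<^esub>)" by simp
    then have "incl D (g (f \<odot>\<^bsub>E.A\<^esub> j)) (sect D f) = sect D f \<otimes>\<^bsub>D.T\<^esub> incl D (g j) \<one>\<^bsub>D.T\<^esub>"
      using f j s by (simp add: h_incl h iso(7)
        three_field_hom_one[OF E.T.three_field_axioms D.T.three_field_axioms iso(3)])
    then have "D.T.u (sect D f) \<oplus>\<^bsub>D.T.U\<^esub> D.\<iota> (g (f \<odot>\<^bsub>E.A\<^esub> j)) =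
        D.T.u (sect D f) \<otimes>\<^bsub>D.T.U\<^esub> (\<one>\<^bsub>D.T.U\<^esub> \<oplus>\<^bsub>D.T.U\<^esub> D.\<iota> (g j))"
      using f j s g by (simp add: D.T.u_mult_u D.T.local_one flip: D.u_incl)
    also have "\<dots> = D.T.u (sect D f) \<oplus>\<^bsub>D.T.U\<^esub> D.\<iota> (f \<odot>\<^bsub>D.A\<^esub> g j)"
      using f j g by (simp add: D.smult(2) D.T.U.r_distr)
    finally have "D.\<iota> (g (f \<odot>\<^bsub>E.A\<^esub> j)) = D.\<iota> (f \<odot>\<^bsub>D.A\<^esub> g j)"
      by (rule D.T.U.add_left_imp_eq) (use f s s' g in simp_all)
    then show ?thesis using D.\<iota>_eqD s s' g by blast
  qed
  then show ?thesis
    unfolding algebra_isomorphic_def using iso(2)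
    by (intro bexI[where x = g]) (auto intro: nonunital_ring_homI simp: g)
qed

lemma (in Q_algebra) split_extension_unitization: "split_extension F (unitization_extension F A)"
  using unitization_split_exact by (rule split_extension.intro)

lemma extension_isomorphic_if_algebra_isomorphic:
  assumes "Q_algebra F A" "Q_algebra F B" "algebra_isomorphic F A B"
  shows "extension_isomorphic F (unitization_extension F A) (unitization_extension F B)"
proof -
  interpret A: Q_algebra F A by fact
  interpret B: Q_algebra F B by fact
  obtain g where hom: "g \<in> nonunital_ring_hom A B" and bij: "bij_betw g (carrier A) (carrier B)"
    and smult: "\<And>f a. f \<in> carrier F \<Longrightarrow> a \<in> carrier A \<Longrightarrow> g (f \<odot>\<^bsub>A\<^esub> a) = f \<odot>\<^bsub>B\<^esub> g a"
    using assms(3) by (auto simp: algebra_isomorphic_def)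
  note g = nonunital_ring_homD[OF hom]
  have g0: "g \<zero>\<^bsub>A\<^esub> = \<zero>\<^bsub>B\<^esub>"
    using g(3)[of "\<zero>\<^bsub>A\<^esub>" "\<zero>\<^bsub>A\<^esub>"] g(1)[of "\<zero>\<^bsub>A\<^esub>"] by simp
  let ?h = "map_prod id g"
  have h: "?h \<in> three_field_hom A.W B.W"
    by (auto simp: three_field_hom_def hom_def g smult A.smult_closed A.A.m_closed)
  have "extension_iso F A.E B.E g ?h"
    unfolding extension_iso_def three_field_iso_def
  proof (intro conjI ballI)
    show "g \<in> nonunital_ring_hom (ideal_part A.E) (ideal_part B.E)"
      by (rule nonunital_ring_homI) (simp_all add: g)
    show "?h \<in> {\<phi> \<in> three_field_hom (total A.E) (total B.E). bij_betw \<phi> (carrier (total A.E)) (carrier (total B.E))}"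
      using h bij bij_betw_map_prod[OF bij_betw_id bij] by simp
    fix j assume "j \<in> carrier (ideal_part A.E)"
    then show "Q_map (total A.E) (total B.E) ?h (incl A.E j) = incl B.E (g j)"
      using incl_one_iff[OF A.split_extension_unitization B.split_extension_unitization, of ?h j "g j"] h g
      by simp
  qed (use bij g0 in auto)
  then show ?thesis by (auto simp: extension_isomorphic_def)
qed

text \<open>Beyond \<open>unitization_iso\<close> two compatibilities remain. For the inclusions
  both sides take the value \<open>1 + j\<close> at 1; for the sections, the ideal component 0 gives
  the translation that fixes \<sigma>(f).\<close>

lemma (in commuting_split_extension) unitization_extension_iso:
  "extension_iso F (unitization_extension F A) E (\<lambda>j. j) (\<lambda>(f, j). incl E j (\<sigma> f))"
proof -
  interpret A: Q_algebra F A by (rule induced_Q_algebra)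
  have h: "(\<lambda>(f, j). incl E j (\<sigma> f)) \<in> three_field_hom (total A.E) T"
    using unitization_iso by (simp add: three_field_iso_def)
  show ?thesis
    unfolding extension_iso_def
  proof (intro conjI ballI)
    show "(\<lambda>j. j) \<in> nonunital_ring_hom (ideal_part A.E) J"
      by (rule nonunital_ring_homI) simp_all
    fix j assume "j \<in> carrier (ideal_part A.E)"
    then show "Q_map (total A.E) T (\<lambda>(f, j). incl E j (\<sigma> f)) (incl A.E j) = incl E j"
      using incl_one_iff[OF A.split_extension_unitization split_extension_axioms h, of j j] by simp
  next
    fix f assume "f \<in> carrier F"
    then show "(\<lambda>(f, j). incl E j (\<sigma> f)) (sect A.E f) = \<sigma> f"
      using u_incl[of "\<zero>\<^bsub>J\<^esub>" "\<sigma> f"] by (simp add: \<iota>_zero)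
  qed (use unitization_iso in \<open>auto simp: bij_betw_def\<close>)
qed

lemma algebra_isomorphic_trans:
  assumes "algebra_isomorphic F A B" "algebra_isomorphic F B C"
  shows "algebra_isomorphic F A C"
proof -
  obtain g where g: "g \<in> nonunital_ring_hom A B" "bij_betw g (carrier A) (carrier B)"
    "\<And>f a. f \<in> carrier F \<Longrightarrow> a \<in> carrier A \<Longrightarrow> g (f \<odot>\<^bsub>A\<^esub> a) = f \<odot>\<^bsub>B\<^esub> g a"
    using assms(1) by (auto simp: algebra_isomorphic_def)
  obtain h where h: "h \<in> nonunital_ring_hom B C" "bij_betw h (carrier B) (carrier C)"
    "\<And>f a. f \<in> carrier F \<Longrightarrow> a \<in> carrier B \<Longrightarrow> h (f \<odot>\<^bsub>B\<^esub> a) = f \<odot>\<^bsub>C\<^esub> h a"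
    using assms(2) by (auto simp: algebra_isomorphic_def)
  note g' = nonunital_ring_homD[OF g(1)] and h' = nonunital_ring_homD[OF h(1)]
  show ?thesis
    unfolding algebra_isomorphic_def
    using bij_betw_trans[OF g(2) h(2)]
    by (intro bexI[where x = "h \<circ> g"]) (auto intro!: nonunital_ring_homI simp: g' h' g(3) h(3))
qed

text \<open>The induced action agrees with the given one on the carriers but may differ outside
  them, so the two records need not be equal. The identity map is an isomorphism all the
  same.\<close>

lemma (in Q_algebra) algebra_isomorphic_induced_unitization:
  "algebra_isomorphic F (induced_algebra (unitization_extension F A)) A"
  "algebra_isomorphic F A (induced_algebra (unitization_extension F A))"
proof -
  interpret E: split_extension F "unitization_extension F A" by (rule split_extension_unitization)
  show "algebra_isomorphic F (induced_algebra (unitization_extension F A)) A"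
    "algebra_isomorphic F A (induced_algebra (unitization_extension F A))"
    unfolding algebra_isomorphic_def
    by (intro bexI[where x = id] nonunital_ring_homI; simp add: induced_unitization)+
qed

text \<open>The bijection is one of isomorphism classes. The first two conjuncts say that the two
  constructions are well defined and undo each other, up to the identity on carriers and up to the
  canonical isomorphism; the last two say that each preserves and reflects isomorphism.\<close>

theorem theorem2p13:
  fixes F :: "'f three_field"
  assumes "unital_three_field F"
  shows
    "(\<forall>A :: ('f, 'a) module. Q_algebra F A \<longrightarrow>
        split_exact F (unitization_extension F A) \<and>
        section_commutes F (unitization_extension F A) \<and>
        (\<forall>f\<in>carrier F. \<forall>a\<in>carrier A.
           f \<odot>\<^bsub>induced_algebra (unitization_extension F A)\<^esub> a = f \<odot>\<^bsub>A\<^esub> a)) \<and>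
     (\<forall>E :: ('f, 'j, 'e) extension. split_exact F E \<and> section_commutes F E \<longrightarrow>
        Q_algebra F (induced_algebra E) \<and>
        extension_iso F (unitization_extension F (induced_algebra E)) E
          (\<lambda>j. j) (\<lambda>(f, j). incl E j (sect E f))) \<and>
     (\<forall>(A :: ('f, 'a) module) (B :: ('f, 'b) module). Q_algebra F A \<and> Q_algebra F B \<longrightarrow>
        (algebra_isomorphic F A B \<longleftrightarrow>
         extension_isomorphic F (unitization_extension F A) (unitization_extension F B))) \<and>
     (\<forall>(E :: ('f, 'j, 'e) extension) (D :: ('f, 'k, 'd) extension).
        split_exact F E \<and> section_commutes F E \<and> split_exact F D \<and> section_commutes F D \<longrightarrow>
        (extension_isomorphic F E D \<longleftrightarrow>
         algebra_isomorphic F (induced_algebra E) (induced_algebra D)))"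
proof (intro conjI allI impI)
  fix A :: "('f, 'a) module" assume "Q_algebra F A"
  then interpret A: Q_algebra F A .
  show "split_exact F (unitization_extension F A)"
    by (rule A.unitization_split_exact)
  show "section_commutes F (unitization_extension F A)"
    by (rule A.unitization_section_commutes)
  show "\<forall>f\<in>carrier F. \<forall>a\<in>carrier A.
      f \<odot>\<^bsub>induced_algebra (unitization_extension F A)\<^esub> a = f \<odot>\<^bsub>A\<^esub> a"
    by (simp add: A.induced_unitization)
next
  fix E :: "('f, 'j, 'e) extension" assume "split_exact F E \<and> section_commutes F E"
  then interpret commuting_split_extension F E by unfold_locales simp_all
  show "Q_algebra F (induced_algebra E)"
    by (rule induced_Q_algebra)
  show "extension_iso F (unitization_extension F (induced_algebra E)) E
      (\<lambda>j. j) (\<lambda>(f, j). incl E j (sect E f))"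
    by (rule unitization_extension_iso)
next
  fix A :: "('f, 'a) module" and B :: "('f, 'b) module"
  assume AB: "Q_algebra F A \<and> Q_algebra F B"
  then interpret A: Q_algebra F A by simp
  interpret B: Q_algebra F B using AB by simp
  show "algebra_isomorphic F A B \<longleftrightarrow>
      extension_isomorphic F (unitization_extension F A) (unitization_extension F B)"
  proof
    assume "extension_isomorphic F (unitization_extension F A) (unitization_extension F B)"
    \<comment> \<open>Each algebra is recovered from its unitization, so the isomorphism is
      transported along A, \<open>induced_algebra A.E\<close>, \<open>induced_algebra B.E\<close>,
      B.\<close>
    then have "algebra_isomorphic F (induced_algebra A.E) (induced_algebra B.E)"
      by (rule algebra_isomorphic_if_extension_isomorphic[OF A.split_extension_unitization
          B.split_extension_unitization])
    then show "algebra_isomorphic F A B"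
      by (rule algebra_isomorphic_trans[OF A.algebra_isomorphic_induced_unitization(2)
          algebra_isomorphic_trans[OF _ B.algebra_isomorphic_induced_unitization(1)]])
  qed (rule extension_isomorphic_if_algebra_isomorphic[OF A.Q_algebra_axioms B.Q_algebra_axioms])
next
  fix E :: "('f, 'j, 'e) extension" and D :: "('f, 'k, 'd) extension"
  assume ED: "split_exact F E \<and> section_commutes F E \<and> split_exact F D \<and> section_commutes F D"
  then interpret E: commuting_split_extension F E by unfold_locales simp_all
  interpret D: commuting_split_extension F D using ED by unfold_locales simp_all
  interpret EA: Q_algebra F E.A by (rule E.induced_Q_algebra)
  interpret DA: Q_algebra F D.A by (rule D.induced_Q_algebra)
  note split = E.split_extension_axioms D.split_extension_axioms
    EA.split_extension_unitization DA.split_extension_unitization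
  show "extension_isomorphic F E D \<longleftrightarrow>
      algebra_isomorphic F (induced_algebra E) (induced_algebra D)"
  proof
    assume "algebra_isomorphic F (induced_algebra E) (induced_algebra D)"
    then obtain g h where gh: "extension_iso F EA.E DA.E g h"
      using extension_isomorphic_if_algebra_isomorphic[OF EA.Q_algebra_axioms DA.Q_algebra_axioms]
      by (auto simp: extension_isomorphic_def)
    \<comment> \<open>The chain runs from \<open>E\<close> to the unitization of its algebra, by the
      reversed canonical isomorphism, then to the unitization of the other algebra, and from there
      to \<open>D\<close>.\<close>
    note extension_iso_trans[OF split(1,3,4) extension_iso_sym[OF split(3,1) E.unitization_extension_iso] gh]
    from extension_iso_trans[OF split(1,4,2) this D.unitization_extension_iso]
    show "extension_isomorphic F E D" unfolding extension_isomorphic_def by blast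
  qed (rule algebra_isomorphic_if_extension_isomorphic[OF split(1,2)])
qed

end
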